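(* Suppose that the past assortments are nested, $S_1\subset\cdots\subset S_M$, and that $S_1,\dots,S_M\in\mathcal{S}$. Let $\theta\in\mathbb{R}$ be a parameter. Then the Pareto optimization problem $$\underset{S\in\mathcal{S}}{\text{maximize}}\ \max_{\lambda\in\mathcal{U}}\mathscr{R}^\lambda(S)\quad\text{subject to}\quad \min_{\lambda\in\mathcal{U}}\mathscr{R}^\lambda(S)\ge\theta$$ can be reformulated as a mixed-integer linear optimization problem with $\mathcal{O}(n)$ binary decision variables, $\mathcal{O}(\mathrm{poly}(n,M))$ continuous decision variables, and $\mathcal{O}(\mathrm{poly}(n,M))$ constraints.
   Context: Products: $\mathcal{N}=\{1,\dots,n\}$, and $0$ is the no-purchase option; $\mathcal{N}_0=\mathcal{N}\cup\{0\}$. Revenues satisfy $0=r_0<r_1<\cdots<r_n$. An assortment is a subset of $\mathcal{N}_0$, and $\mathcal{S}=\{S\subseteq\mathcal{N}_0: 0\in S\}$. Data: past assortments $S_1,\dots,S_M\subseteq\mathcal{N}_0$ with index set $\mathcal{M}=\{1,\dots,M\}$, and historical sales data $v_{m,i}\in[0,1]$ ($m\in\mathcal{M}$, $i\in\mathcal{N}_0$) with $\sum_{i\in\mathcal{N}_0}v_{m,i}=1$ for each $m$ and $v_{m,i}=0$ for $i\notin S_m$. Ranking-based choice models: $\Sigma$ is the set of all rankings, i.e. bijections $\sigma:\mathcal{N}_0\to\{0,\dots,n\}$. $\Delta_\Sigma$ is the set of probability distributions $\lambda=(\lambda_\sigma)_{\sigma\in\Sigma}$ on $\Sigma$. For $\lambda\in\Delta_\Sigma$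 and an assortment $S$, $\mathscr{D}^\lambda_i(S)=\sum_{\sigma\in\Sigma}\mathbb{I}\{i=\arg\min_{j\in S}\sigma(j)\}\lambda_\sigma$ and $\mathscr{R}^\lambda(S)=\sum_{i\in\mathcal{N}_0}r_i\mathscr{D}^\lambda_i(S)$. Uncertainty set: for a radius $\eta\ge 0$ and $\|\cdot\|$ either the $\ell_1$- or $\ell_\infty$-norm, $\mathcal{U}$ is the set of $\lambda\in\Delta_\Sigma$ for which there is a vector $\epsilon=(\epsilon_{m,i})_{m\in\mathcal{M},i\in S_m}$ with $\|\epsilon\|\le\eta$ and $\mathscr{D}^\lambda_i(S_m)-v_{m,i}=\epsilon_{m,i}$ for all $m\in\mathcal{M}$, $i\in S_m$. Standing assumption: $\mathcal{U}\neq\emptyset$. "Can be reformulated as" means equivalence of optimization problems: equal optimal values, with an optimal assortment recoverable from the binary decision variables of an optimal solution. *)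

theory Defs
  imports Complex_Main "HOL-Library.Extended_Real" "HOL-Combinatorics.Permutations"
begin

section \<open>Ranking-based choice models\<close>

text \<open>Products with the no-purchase option are the numbers \<open>{..n}\<close>; \<open>0\<close> is no-purchase.\<close>

definition assortments :: "nat \<Rightarrow> nat set set" where
  "assortments n = {S. S \<subseteq> {..n} \<and> 0 \<in> S}"

text \<open>
  A ranking is a bijection of \<open>{..n}\<close> onto itself. Using \<open>permutes\<close> (identity outside \<open>{..n}\<close>)
  makes each such bijection occur exactly once, so that sums over rankings are correct.
\<close>

definition rankings :: "nat \<Rightarrow> (nat \<Rightarrow> nat) set" where
  "rankings n = {\<sigma>. \<sigma> permutes {..n}}"

definition ranking_distributions :: "nat \<Rightarrow> ((nat \<Rightarrow> nat) \<Rightarrow> real) set" where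
  "ranking_distributions n =
     {lam. (\<forall>\<sigma>\<in>rankings n. 0 \<le> lam \<sigma>) \<and> (\<Sum>\<sigma>\<in>rankings n. lam \<sigma>) = 1}"

definition choice_prob :: "nat \<Rightarrow> ((nat \<Rightarrow> nat) \<Rightarrow> real) \<Rightarrow> nat \<Rightarrow> nat set \<Rightarrow> real" where
  "choice_prob n lam i S = (\<Sum>\<sigma>\<in>rankings n. of_bool (i = arg_min_on \<sigma> S) * lam \<sigma>)"

definition revenue ::
  "nat \<Rightarrow> (nat \<Rightarrow> real) \<Rightarrow> ((nat \<Rightarrow> nat) \<Rightarrow> real) \<Rightarrow> nat set \<Rightarrow> real" where
  "revenue n r lam S = (\<Sum>i\<le>n. r i * choice_prob n lam i S)"

section \<open>Historical data and the uncertainty set\<close>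

datatype norm_kind = L1 | Linf

fun err_norm :: "norm_kind \<Rightarrow> 'i set \<Rightarrow> ('i \<Rightarrow> real) \<Rightarrow> real" where
  "err_norm L1 I e = (\<Sum>p\<in>I. \<bar>e p\<bar>)"
| "err_norm Linf I e = Max ((\<lambda>p. \<bar>e p\<bar>) ` I)"

definition uncertainty_set ::
  "nat \<Rightarrow> nat \<Rightarrow> (nat \<Rightarrow> nat set) \<Rightarrow> norm_kind \<Rightarrow> (nat \<Rightarrow> nat \<Rightarrow> real) \<Rightarrow> real
    \<Rightarrow> ((nat \<Rightarrow> nat) \<Rightarrow> real) set" where
  "uncertainty_set n M A nk v \<eta> =
     {lam \<in> ranking_distributions n.
        \<exists>e. err_norm nk (SIGMA m:{1..M}. A m) e \<le> \<eta> \<and>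
            (\<forall>m\<in>{1..M}. \<forall>i\<in>A m. choice_prob n lam i (A m) - v m i = e (m, i))}"

definition nested_assortments :: "nat \<Rightarrow> nat \<Rightarrow> (nat \<Rightarrow> nat set) \<Rightarrow> bool" where
  "nested_assortments n M A \<longleftrightarrow>
     (\<forall>m\<in>{1..M}. A m \<in> assortments n) \<and> (\<forall>m\<in>{1..<M}. A m \<subseteq> A (Suc m))"

definition valid_revenues :: "nat \<Rightarrow> (nat \<Rightarrow> real) \<Rightarrow> bool" where
  "valid_revenues n r \<longleftrightarrow> r 0 = 0 \<and> (\<forall>i<n. r i < r (Suc i))"

definition valid_sales ::
  "nat \<Rightarrow> nat \<Rightarrow> (nat \<Rightarrow> nat set) \<Rightarrow> (nat \<Rightarrow> nat \<Rightarrow> real) \<Rightarrow> bool" where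
  "valid_sales n M A v \<longleftrightarrow>
     (\<forall>m\<in>{1..M}. (\<forall>i\<le>n. 0 \<le> v m i \<and> v m i \<le> 1) \<and> (\<Sum>i\<le>n. v m i) = 1 \<and>
        (\<forall>i\<le>n. i \<notin> A m \<longrightarrow> v m i = 0))"

section \<open>The Pareto problem\<close>

text \<open>
  For nonempty uncertainty sets, the suprema and infima below are those of a linear function over
  a nonempty polytope (in the coordinates \<open>rankings n\<close>), hence attained.
\<close>

definition best_case ::
  "nat \<Rightarrow> (nat \<Rightarrow> real) \<Rightarrow> ((nat \<Rightarrow> nat) \<Rightarrow> real) set \<Rightarrow> nat set \<Rightarrow> real" where
  "best_case n r U S = (SUP lam\<in>U. revenue n r lam S)"

definition worst_case ::
  "nat \<Rightarrow> (nat \<Rightarrow> real) \<Rightarrow> ((nat \<Rightarrow> nat) \<Rightarrow> real) set \<Rightarrow> nat set \<Rightarrow> real" where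
  "worst_case n r U S = (INF lam\<in>U. revenue n r lam S)"

definition pareto_feasible ::
  "nat \<Rightarrow> (nat \<Rightarrow> real) \<Rightarrow> ((nat \<Rightarrow> nat) \<Rightarrow> real) set \<Rightarrow> real \<Rightarrow> nat set set" where
  "pareto_feasible n r U \<theta> = {S \<in> assortments n. \<theta> \<le> worst_case n r U S}"

section \<open>Mixed-integer linear optimization problems\<close>

text \<open>
  The problem is to maximize \<open>obj_bin \<bullet> x + obj_cont \<bullet> y\<close> subject to
  \<open>con_bin x + con_cont y \<le> con_rhs\<close> with \<open>x\<close> binary and \<open>y\<close> real. Equations are pairs of
  inequalities, and bounds on \<open>y\<close> are counted as constraints. Indices run from \<open>1\<close>; the values of
  the coefficient functions outside the index ranges are irrelevant. The coefficient type is a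
  parameter so that both concrete problems and problem schemes can be expressed.
\<close>

datatype 'c milp = MILP
  (num_bin: nat) (num_cont: nat) (num_con: nat)
  (obj_bin: "nat \<Rightarrow> 'c") (obj_cont: "nat \<Rightarrow> 'c")
  (con_bin: "nat \<Rightarrow> nat \<Rightarrow> 'c") (con_cont: "nat \<Rightarrow> nat \<Rightarrow> 'c") (con_rhs: "nat \<Rightarrow> 'c")

definition milp_feasible :: "real milp \<Rightarrow> ((nat \<Rightarrow> real) \<times> (nat \<Rightarrow> real)) set" where
  "milp_feasible P =
     {(x, y). (\<forall>j\<in>{1..num_bin P}. x j \<in> {0, 1}) \<and>
        (\<forall>k\<in>{1..num_con P}.
           (\<Sum>j=1..num_bin P. con_bin P k j * x j) + (\<Sum>j=1..num_cont P. con_cont P k j * y j)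
             \<le> con_rhs P k)}"

definition milp_objective :: "real milp \<Rightarrow> (nat \<Rightarrow> real) \<times> (nat \<Rightarrow> real) \<Rightarrow> real" where
  "milp_objective P = (\<lambda>(x, y).
     (\<Sum>j=1..num_bin P. obj_bin P j * x j) + (\<Sum>j=1..num_cont P. obj_cont P j * y j))"

text \<open>
  For a fixed numerical instance, some tiny problem with the right optimal value and solution
  always exists, since an optimal assortment can be hard-coded. A reformulation is therefore given by a scheme that is fixed
  before the numerical data \<open>r\<close>, \<open>v\<close>, \<open>\<eta>\<close>, \<open>\<theta>\<close> are, and whose coefficients are affine
  expressions in these data.
\<close>

datatype affine_form =
  Affine real "nat \<Rightarrow> real" "nat \<Rightarrow> nat \<Rightarrow> real" real real

fun eval_form ::
  "nat \<Rightarrow> nat \<Rightarrow> (nat \<Rightarrow> real) \<Rightarrow> (nat \<Rightarrow> nat \<Rightarrow> real) \<Rightarrow> real \<Rightarrow> real \<Rightarrow> affine_form \<Rightarrow> real" where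
  "eval_form n M r v \<eta> \<theta> (Affine c a b p q) =
     c + (\<Sum>i\<le>n. a i * r i) + (\<Sum>m=1..M. \<Sum>i\<le>n. b m i * v m i) + p * \<eta> + q * \<theta>"

definition instantiate ::
  "nat \<Rightarrow> nat \<Rightarrow> (nat \<Rightarrow> real) \<Rightarrow> (nat \<Rightarrow> nat \<Rightarrow> real) \<Rightarrow> real \<Rightarrow> real \<Rightarrow> affine_form milp \<Rightarrow> real milp"
  where "instantiate n M r v \<eta> \<theta> = map_milp (eval_form n M r v \<eta> \<theta>)"

section \<open>Equivalence of maximization problems\<close>

text \<open>The value of an infeasible problem is \<open>-\<infinity>\<close>, so equal values entail equal feasibility status.\<close>

definition optimal_value :: "'a set \<Rightarrow> ('a \<Rightarrow> real) \<Rightarrow> ereal" where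
  "optimal_value F f = (SUP s\<in>F. ereal (f s))"

definition optimal_solution :: "'a set \<Rightarrow> ('a \<Rightarrow> real) \<Rightarrow> 'a \<Rightarrow> bool" where
  "optimal_solution F f = is_arg_max f (\<lambda>s. s \<in> F)"

definition reformulates ::
  "('z \<Rightarrow> 'a) \<Rightarrow> 'z set \<Rightarrow> ('z \<Rightarrow> real) \<Rightarrow> 'a set \<Rightarrow> ('a \<Rightarrow> real) \<Rightarrow> bool" where
  "reformulates decode G g F f \<longleftrightarrow>
     optimal_value G g = optimal_value F f \<and>
     ((\<exists>s. optimal_solution F f s) \<longrightarrow> (\<exists>z. optimal_solution G g z)) \<and>
     (\<forall>z. optimal_solution G g z \<longrightarrow> optimal_solution F f (decode z))"

text \<open>The assortment is read off the first \<open>n\<close> binary variables.\<close>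

definition decode_assortment :: "nat \<Rightarrow> (nat \<Rightarrow> real) \<times> (nat \<Rightarrow> real) \<Rightarrow> nat set" where
  "decode_assortment n = (\<lambda>(x, y). insert 0 {i \<in> {1..n}. x i = 1})"

end

theory Submission
  imports Defs
begin

text \<open>
  The set of rankings is exponentially large, but for nested past assortments only little of a
  ranking matters. Let \<open>c m\<close> be the choice from the \<open>m\<close>-th past assortment and \<open>k\<close> the choice from
  the new assortment \<open>S\<close>. Since the assortments grow, \<open>c (Suc m)\<close> is either \<open>c m\<close> or a product that
  is new in \<open>A (Suc m)\<close>, so \<open>c\<close> is a path in a graph with one layer per past assortment. A path \<open>c\<close>
  and a product \<open>k \<in> S\<close> come from a common ranking if and only if no \<open>m\<close> has \<open>k \<in> A m\<close>,
  \<open>c m \<noteq> k\<close> and \<open>c m \<in> S\<close>: such an \<open>m\<close> would rank \<open>c m\<close> before \<open>k\<close> in \<open>A m\<close> and \<open>k\<close> before \<open>c m\<close>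
  in \<open>S\<close>, and without one a ranking can be written down (\<open>choice_path_realizable\<close>). For a fixed \<open>k\<close>
  this condition concerns each node of the path separately, so that \<open>S\<close> merely deletes nodes from
  the graph. The program uses one copy of the graph for each \<open>k\<close>, and the binary variables are the
  indicators of \<open>S\<close>.

  The constraint on the worst case needs a certificate that all distributions in the uncertainty
  set have revenue at least \<open>\<theta>\<close>. Linear programming duality provides multipliers \<open>\<beta> (m, i)\<close> for the
  sales data and a multiplier \<open>\<gamma>\<close> for the total mass, with one inequality
  \<open>- r k \<le> \<gamma> + (\<Sum>m. \<beta> (m, c m))\<close> for each ranking. These inequalities bound the longest path in
  each graph, hence are equivalent to the existence of node potentials. The assortment appears only
  in the weights, linearly: a deleted node costs \<open>r n\<close>, and a product \<open>k \<notin> S\<close> counts as earning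
  \<open>r n\<close>. The multipliers are not bounded in advance, but no bound on them is needed: the additional inequalities for pairs
  \<open>(c, k)\<close> without a common ranking all follow from \<open>(\<Sum>m. - \<beta> (m, c m)) \<le> \<gamma> + r n\<close>, which holds
  because every path belongs to some ranking and no product earns more than \<open>r n\<close>
  (\<open>guarantee_certificate_sound\<close>, \<open>guarantee_certificate_complete\<close>).

  The objective needs a certificate that some distribution in the uncertainty set has a large
  revenue. A flow on the graphs is used, with capacity \<open>1 - x i\<close> on the nodes that \<open>i \<in> S\<close>
  deletes and total flow at most \<open>x k\<close> in the \<open>k\<close>-th graph. A distribution induces such a flow.
  Conversely no distribution has to be assembled from a flow: by duality the best case is attained
  and has optimal multipliers, and weighting the flow by these multipliers shows that its value
  cannot exceed the best case (\<open>optimism_certificate_sound\<close>, \<open>optimism_certificate_complete\<close>).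

  The duality theorem comes from Fourier-Motzkin elimination (\<open>lp_duality\<close>). Both certificates
  consist of polynomially many linear inequalities whose coefficients are affine in the data;
  closure properties of such systems turn them into a problem scheme (\<open>linear_system_milp\<close>).
\<close>

section \<open>Elimination and duality for finite linear programs\<close>

text \<open>
  A pair \<open>(a, b)\<close> stands for the inequality \<open>(\<Sum>j. a j * y j) \<le> b\<close>. Elimination only ever forms
  nonnegative combinations of the given inequalities, so whatever it derives from inequalities in
  a cone stays in the cone. Choosing for the cone the inequalities with a certificate of a desired
  shape makes duality produce certificates of that shape.
\<close>

definition inequality_cone :: "(('j \<Rightarrow> real) \<times> real) set \<Rightarrow> bool" where
  "inequality_cone D \<longleftrightarrow> ((\<lambda>_. 0), 0) \<in> D \<and>
     (\<forall>a b a' b'. (a, b) \<in> D \<longrightarrow> (a', b') \<in> D \<longrightarrow> ((\<lambda>j. a j + a' j), b + b') \<in> D) \<and>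
     (\<forall>c a b. 0 \<le> c \<longrightarrow> (a, b) \<in> D \<longrightarrow> ((\<lambda>j. c * a j), c * b) \<in> D)"

definition satisfies :: "'j set \<Rightarrow> ('j \<Rightarrow> real) \<Rightarrow> (('j \<Rightarrow> real) \<times> real) set \<Rightarrow> bool" where
  "satisfies V y C \<longleftrightarrow> (\<forall>(a, b)\<in>C. (\<Sum>j\<in>V. a j * y j) \<le> b)"

lemma inequality_cone_combine:
  assumes "inequality_cone D" "(a, b) \<in> D" "(a', b') \<in> D" "0 \<le> s" "0 \<le> t"
  shows "((\<lambda>j. s * a j + t * a' j), s * b + t * b') \<in> D"
  using assms unfolding inequality_cone_def by blast

lemma inequality_cone_Int:
  assumes "inequality_cone D" "inequality_cone E"
  shows "inequality_cone (D \<inter> E)"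
  using assms unfolding inequality_cone_def by simp

lemma separate_finite_sets:
  fixes L U :: "real set"
  assumes "finite L" "finite U" "\<And>l u. l \<in> L \<Longrightarrow> u \<in> U \<Longrightarrow> l \<le> u"
  shows "\<exists>t. (\<forall>l\<in>L. l \<le> t) \<and> (\<forall>u\<in>U. t \<le> u)"
proof (cases "L = {}")
  case True
  show ?thesis
  proof (cases "U = {}")
    case False
    then show ?thesis using True assms by (intro exI[of _ "Min U"]) auto
  qed (use True in auto)
next
  case False
  then show ?thesis using assms by (intro exI[of _ "Max L"]) auto
qed

text \<open>
  One round of Fourier-Motzkin elimination: each pair of an inequality that bounds \<open>x\<close> from above
  and one that bounds it from below is combined so that \<open>x\<close> cancels. If the combinations hold,
  all lower bounds for \<open>x\<close> are below all upper bounds, which leaves room for a value of \<open>x\<close>.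
\<close>

lemma eliminate_variable:
  assumes V: "finite V" "x \<in> V" and C: "finite C" "C \<subseteq> D" and D: "inequality_cone D"
  shows "\<exists>C'. finite C' \<and> C' \<subseteq> D \<and> (\<forall>(a, b)\<in>C'. a x = 0) \<and>
           (\<forall>y. satisfies V y C' \<longrightarrow> (\<exists>t. satisfies V (y(x := t)) C))"
proof -
  define P where "P = {q \<in> C. fst q x > 0}"
  define N where "N = {q \<in> C. fst q x < 0}"
  define Z where "Z = {q \<in> C. fst q x = 0}"
  define comb where "comb = (\<lambda>(p :: ('a \<Rightarrow> real) \<times> real, q :: ('a \<Rightarrow> real) \<times> real).
     ((\<lambda>j. (- fst q x) * fst p j + fst p x * fst q j), (- fst q x) * snd p + fst p x * snd q))"
  define C' where "C' = Z \<union> comb ` (P \<times> N)"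
  have fin: "finite P" "finite N" "finite Z" using C by (auto simp: P_def N_def Z_def)
  have "comb (p, q) \<in> D" if "p \<in> P" "q \<in> N" for p q
    using that C(2) inequality_cone_combine[OF D, of "fst p" "snd p" "fst q" "snd q" "- fst q x" "fst p x"]
    by (auto simp: comb_def P_def N_def)
  then have sub: "C' \<subseteq> D" using C(2) by (auto simp: C'_def Z_def)
  have zero: "\<forall>(a, b)\<in>C'. a x = 0"
    by (auto simp: C'_def Z_def comb_def)
  have "\<exists>t. satisfies V (y(x := t)) C" if y: "satisfies V y C'" for y
  proof -
    define rest where "rest = (\<lambda>a :: 'a \<Rightarrow> real. \<Sum>j\<in>V - {x}. a j * y j)"
    have ev: "(\<Sum>j\<in>V. a j * (y(x := t)) j) = a x * t + rest a" for a t
    proof -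
      have "(\<Sum>j\<in>V. a j * (y(x := t)) j) = a x * t + (\<Sum>j\<in>V - {x}. a j * (y(x := t)) j)"
        using V by (subst sum.remove[of V x]) auto
      also have "(\<Sum>j\<in>V - {x}. a j * (y(x := t)) j) = rest a"
        unfolding rest_def by (intro sum.cong) auto
      finally show ?thesis .
    qed
    have ev0: "(\<Sum>j\<in>V. a j * y j) = a x * y x + rest a" for a
      using ev[of a "y x"] by simp
    define bound where "bound = (\<lambda>p :: ('a \<Rightarrow> real) \<times> real. (snd p - rest (fst p)) / fst p x)"
    have "bound q \<le> bound p" if pq: "p \<in> P" "q \<in> N" for p q
    proof -
      have pos: "fst p x > 0" "fst q x < 0" using pq by (auto simp: P_def N_def)
      have "comb (p, q) \<in> C'" using pq by (auto simp: C'_def)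
      then have "(\<Sum>j\<in>V. fst (comb (p, q)) j * y j) \<le> snd (comb (p, q))"
        using y by (auto simp: satisfies_def case_prod_beta)
      then have "(- fst q x) * rest (fst p) + fst p x * rest (fst q)
          \<le> (- fst q x) * snd p + fst p x * snd q"
        unfolding ev0 by (simp add: comb_def rest_def sum.distrib sum_distrib_left algebra_simps
            sum_negf flip: sum_subtractf)
      then show ?thesis using pos by (simp add: bound_def field_simps)
    qed
    then have "\<exists>t. (\<forall>l\<in>bound ` N. l \<le> t) \<and> (\<forall>u\<in>bound ` P. t \<le> u)"
      using fin by (intro separate_finite_sets) auto
    then obtain t where t: "\<And>q. q \<in> N \<Longrightarrow> bound q \<le> t" "\<And>p. p \<in> P \<Longrightarrow> t \<le> bound p"
      by auto
    have "fst p x * t + rest (fst p) \<le> snd p" if "p \<in> C" for p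
    proof -
      consider "fst p x > 0" | "fst p x < 0" | "fst p x = 0" by linarith
      then show ?thesis
      proof cases
        case 1
        then have "t \<le> bound p" using t that by (auto simp: P_def)
        then show ?thesis using 1 by (simp add: bound_def pos_le_divide_eq mult.commute)
      next
        case 2
        then have "bound p \<le> t" using t that by (auto simp: N_def)
        then show ?thesis using 2 by (simp add: bound_def neg_divide_le_eq mult.commute)
      next
        case 3
        then have "p \<in> C'" using that by (auto simp: C'_def Z_def)
        then have "(\<Sum>j\<in>V. fst p j * y j) \<le> snd p" using y by (auto simp: satisfies_def case_prod_beta)
        then show ?thesis using 3 by (simp add: ev0)
      qed
    qed
    then have "satisfies V (y(x := t)) C" unfolding satisfies_def ev by auto
    then show ?thesis ..
  qed
  then show ?thesis using sub zero fin by (intro exI[of _ C']) (auto simp: C'_def)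
qed

text \<open>
  To keep the coefficients of variables that are already eliminated at zero, each further round is
  carried out in the smaller cone of inequalities that do not mention them.
\<close>

lemma eliminate_variables:
  assumes "finite X" "finite V" "X \<subseteq> V" "finite C" "C \<subseteq> D" "inequality_cone D"
  shows "\<exists>C'. finite C' \<and> C' \<subseteq> D \<and> (\<forall>(a, b)\<in>C'. \<forall>x\<in>X. a x = 0) \<and>
           (\<forall>y. satisfies V y C' \<longrightarrow> (\<exists>y'. (\<forall>j. j \<notin> X \<longrightarrow> y' j = y j) \<and> satisfies V y' C))"
  using assms(1,3)
proof (induction X rule: finite_induct)
  case empty
  then show ?case using assms by (intro exI[of _ C]) auto
next
  case (insert x X)
  then obtain C1 where C1: "finite C1" "C1 \<subseteq> D" "\<forall>(a, b)\<in>C1. \<forall>x\<in>X. a x = 0"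
    "\<And>y. satisfies V y C1 \<Longrightarrow> \<exists>y'. (\<forall>j. j \<notin> X \<longrightarrow> y' j = y j) \<and> satisfies V y' C"
    by auto
  let ?D = "{(a, b) \<in> D. \<forall>x\<in>X. a x = 0}"
  have cone: "inequality_cone ?D" using assms(6) by (auto simp: inequality_cone_def)
  have x: "x \<in> V" and C1D: "C1 \<subseteq> ?D" using insert.prems C1(2,3) by auto
  obtain C2 where C2: "finite C2" "C2 \<subseteq> ?D" "\<forall>(a, b)\<in>C2. a x = 0"
    "\<And>y. satisfies V y C2 \<Longrightarrow> \<exists>t. satisfies V (y(x := t)) C1"
    using eliminate_variable[OF assms(2) x C1(1) C1D cone] by blast
  have "\<exists>y'. (\<forall>j. j \<notin> insert x X \<longrightarrow> y' j = y j) \<and> satisfies V y' C"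
    if y: "satisfies V y C2" for y
  proof -
    obtain t where "satisfies V (y(x := t)) C1" using C2(4)[OF y] by blast
    then obtain y' where "\<forall>j. j \<notin> X \<longrightarrow> y' j = (y(x := t)) j" "satisfies V y' C"
      using C1(4)[of "y(x := t)"] by blast
    then show ?thesis by (intro exI[of _ y']) auto
  qed
  moreover have "C2 \<subseteq> D" "\<forall>(a, b)\<in>C2. \<forall>z\<in>insert x X. a z = 0" using C2(2,3) by auto
  ultimately show ?case using C2(1) by blast
qed

text \<open>
  A new coordinate \<open>None\<close> is constrained to be at most the objective, and all other variables are
  eliminated. What remains are finitely many bounds \<open>w * z \<le> b\<close> on this coordinate, each derived with
  a multiplier \<open>w\<close> for the objective and a multiplier combination of the constraints; the smallest
  \<open>b / w\<close> is the optimal value. It is attained because elimination preserves solvability, and the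
  bound it comes from, divided by \<open>w\<close>, is the dual solution.
\<close>

theorem lp_duality:
  assumes V: "finite V" and C: "finite C" "C \<subseteq> D" and D: "inequality_cone D"
    and feasible: "satisfies V y0 C"
    and bounded: "\<And>y. satisfies V y C \<Longrightarrow> (\<Sum>j\<in>V. c j * y j) \<le> K"
  shows "\<exists>y a b. satisfies V y C \<and> (a, b) \<in> D \<and> (\<forall>j\<in>V. a j = c j) \<and> b = (\<Sum>j\<in>V. c j * y j)"
proof -
  let ?valid = "{(a, b). \<forall>y. satisfies V y C \<longrightarrow> (\<Sum>j\<in>V. a j * y j) \<le> b}"
  have valid: "inequality_cone ?valid"
    unfolding inequality_cone_def
  proof (intro conjI allI impI)
    fix a b a' b' assume "(a, b) \<in> ?valid" "(a', b') \<in> ?valid"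
    then show "((\<lambda>j. a j + a' j), b + b') \<in> ?valid"
      by (auto simp: distrib_right sum.distrib intro!: add_mono)
  next
    fix t a b assume "(0::real) \<le> t" "(a, b) \<in> ?valid"
    then show "((\<lambda>j. t * a j), t * b) \<in> ?valid"
      by (auto simp: mult.assoc sum_distrib_left[symmetric] intro!: mult_left_mono)
  qed simp
  \<comment> \<open>The inequality \<open>a\<close> is \<open>a0\<close> plus \<open>w\<close> times the inequality that bounds the coordinate \<open>None\<close> by the
    objective. Intersecting with the valid inequalities makes everything derived hold on the
    feasible set.\<close>
  define E where "E = {(a, b). \<exists>w a0. 0 \<le> w \<and> (a0, b) \<in> D \<inter> ?valid \<and> a None = w \<and>
     (\<forall>j\<in>V. a (Some j) = a0 j - w * c j)}"
  have E: "inequality_cone E"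
  proof -
    have DV: "inequality_cone (D \<inter> ?valid)"
      using D valid by (rule inequality_cone_Int)
    show ?thesis unfolding inequality_cone_def
    proof (intro conjI allI impI)
      have "((\<lambda>_. 0), 0) \<in> D \<inter> ?valid" using DV unfolding inequality_cone_def by blast
      then show "((\<lambda>_. 0), 0) \<in> E"
        unfolding E_def by (intro CollectI case_prodI exI[of _ 0] exI[of _ "\<lambda>_. 0"]) simp
    next
      fix a b a' b' assume "(a, b) \<in> E" "(a', b') \<in> E"
      then obtain w a0 w' a0' where *: "0 \<le> w" "(a0, b) \<in> D \<inter> ?valid" "a None = w"
        "\<forall>j\<in>V. a (Some j) = a0 j - w * c j" "0 \<le> w'" "(a0', b') \<in> D \<inter> ?valid" "a' None = w'"
        "\<forall>j\<in>V. a' (Some j) = a0' j - w' * c j"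
        unfolding E_def by blast
      have "((\<lambda>j. a0 j + a0' j), b + b') \<in> D \<inter> ?valid"
        using DV *(2,6) unfolding inequality_cone_def by blast
      then show "((\<lambda>j. a j + a' j), b + b') \<in> E"
        unfolding E_def using *(1,3,4,5,7,8)
        by (intro CollectI case_prodI exI[of _ "w + w'"] exI[of _ "\<lambda>j. a0 j + a0' j"])
          (simp add: algebra_simps)
    next
      fix t a b assume t: "(0::real) \<le> t" and "(a, b) \<in> E"
      then obtain w a0 where *: "0 \<le> w" "(a0, b) \<in> D \<inter> ?valid" "a None = w"
        "\<forall>j\<in>V. a (Some j) = a0 j - w * c j"
        unfolding E_def by blast
      have "((\<lambda>j. t * a0 j), t * b) \<in> D \<inter> ?valid"
        using DV *(2) t unfolding inequality_cone_def by blast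
      then show "((\<lambda>j. t * a j), t * b) \<in> E"
        unfolding E_def using *(1,3,4) t
        by (intro CollectI case_prodI exI[of _ "t * w"] exI[of _ "\<lambda>j. t * a0 j"])
          (simp add: right_diff_distrib mult.assoc)
    qed
  qed
  define lift where "lift = (\<lambda>(a :: 'a \<Rightarrow> real, b :: real).
     ((\<lambda>j. case j of None \<Rightarrow> 0 | Some j \<Rightarrow> a j), b))"
  define top where "top = ((\<lambda>j. case j of None \<Rightarrow> 1 | Some j \<Rightarrow> - c j) :: 'a option \<Rightarrow> real, 0 :: real)"
  define V' where "V' = insert None (Some ` V)"
  have ev: "(\<Sum>j\<in>V'. a j * y j) = a None * y None + (\<Sum>j\<in>V. a (Some j) * y (Some j))" for a y :: "'a option \<Rightarrow> real"
    unfolding V'_def using V by (simp add: sum.reindex)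
  have zero: "((\<lambda>_. 0), 0) \<in> D \<inter> ?valid" using D by (auto simp: inequality_cone_def)
  have CE: "insert top (lift ` C) \<subseteq> E"
  proof -
    have "top \<in> E" unfolding E_def top_def
      using zero by (intro CollectI case_prodI exI[of _ 1] exI[of _ "\<lambda>_. 0"]) auto
    moreover have "lift (a, b) \<in> E" if "(a, b) \<in> C" for a b
    proof -
      have "(a, b) \<in> D \<inter> ?valid" using that C(2) unfolding satisfies_def by auto
      then show ?thesis unfolding E_def lift_def
        by (auto intro!: exI[of _ a])
    qed
    ultimately show ?thesis by auto
  qed
  have "finite (Some ` V)" "finite V'" "Some ` V \<subseteq> V'" "finite (insert top (lift ` C))"
    using V C by (auto simp: V'_def)
  from eliminate_variables[OF this CE E] obtain R where R: "finite R" "R \<subseteq> E"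
    "\<forall>(a, b)\<in>R. \<forall>x\<in>Some ` V. a x = 0"
    "\<And>y. satisfies V' y R \<Longrightarrow> \<exists>y'. (\<forall>j. j \<notin> Some ` V \<longrightarrow> y' j = y j) \<and> satisfies V' y' (insert top (lift ` C))"
    by auto
  have R_cert: "0 \<le> a None \<and> (\<exists>a0. (a0, b) \<in> D \<inter> ?valid \<and> (\<forall>j\<in>V. a0 j = a None * c j))"
    if "(a, b) \<in> R" for a b
    using that R(2,3) unfolding E_def by fastforce
  have R_valid: "a None * (\<Sum>j\<in>V. c j * y j) \<le> b" if ab: "(a, b) \<in> R" and y: "satisfies V y C" for a b y
  proof -
    obtain a0 where a0: "(a0, b) \<in> ?valid" "\<forall>j\<in>V. a0 j = a None * c j" using R_cert[OF ab] by blast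
    have "(\<Sum>j\<in>V. a0 j * y j) \<le> b" using a0(1) y by simp
    also have "(\<Sum>j\<in>V. a0 j * y j) = a None * (\<Sum>j\<in>V. c j * y j)"
      using a0(2) by (simp add: sum_distrib_left mult.assoc)
    finally show ?thesis .
  qed
  have attained: "\<exists>y. satisfies V y C \<and> t \<le> (\<Sum>j\<in>V. c j * y j)"
    if t: "\<And>a b. (a, b) \<in> R \<Longrightarrow> a None * t \<le> b" for t
  proof -
    have "satisfies V' (\<lambda>j. case j of None \<Rightarrow> t | Some _ \<Rightarrow> 0) R"
      using t R(3) by (auto simp: satisfies_def ev)
    from R(4)[OF this] obtain y' where y': "y' None = t" "satisfies V' y' (insert top (lift ` C))"
      by auto
    have "satisfies V (\<lambda>j. y' (Some j)) C"
      using y'(2) by (auto simp: satisfies_def lift_def ev)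
    moreover have "t \<le> (\<Sum>j\<in>V. c j * y' (Some j))"
      using y' by (auto simp: satisfies_def top_def ev sum_negf)
    ultimately show ?thesis by (intro exI[of _ "\<lambda>j. y' (Some j)"]) auto
  qed
  define Q where "Q = {q \<in> R. fst q None > 0}"
  define ratio where "ratio = (\<lambda>q :: ('a option \<Rightarrow> real) \<times> real. snd q / fst q None)"
  \<comment> \<open>Without a bound that involves the coordinate \<open>None\<close>, the objective could be made larger than \<open>K\<close>.\<close>
  have "Q \<noteq> {}"
  proof
    assume "Q = {}"
    then have none: "a None = 0" if "(a, b) \<in> R" for a b
      using that R_cert[OF that] by (force simp: Q_def)
    have "\<exists>y. satisfies V y C \<and> K + 1 \<le> (\<Sum>j\<in>V. c j * y j)"
    proof (rule attained)
      fix a b assume ab: "(a, b) \<in> R"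
      show "a None * (K + 1) \<le> b" using none[OF ab] R_valid[OF ab feasible] by simp
    qed
    then show False using bounded by force
  qed
  moreover have "finite Q" using R(1) by (auto simp: Q_def)
  ultimately have "Min (ratio ` Q) \<in> ratio ` Q" by (intro Min_in) auto
  then obtain q where q: "q \<in> Q" "ratio q = Min (ratio ` Q)" by auto
  have "a None * ratio q \<le> b" if ab: "(a, b) \<in> R" for a b
  proof (cases "a None = 0")
    case True
    then show ?thesis using R_valid[OF ab feasible] by simp
  next
    case False
    then have pos: "a None > 0" using R_cert[OF ab] by simp
    then have "ratio q \<le> ratio (a, b)" using q(2) ab \<open>finite Q\<close> by (auto simp: Q_def)
    then show ?thesis using pos by (simp add: ratio_def field_simps)
  qed
  then obtain y where y: "satisfies V y C" "ratio q \<le> (\<Sum>j\<in>V. c j * y j)"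
    using attained by blast
  obtain a b where ab: "q = (a, b)" by force
  then have abR: "(a, b) \<in> R" "a None > 0" using q(1) by (auto simp: Q_def)
  obtain a0 where a0: "(a0, b) \<in> D" "\<forall>j\<in>V. a0 j = a None * c j" using R_cert[OF abR(1)] by blast
  have "(\<Sum>j\<in>V. c j * y j) \<le> ratio q"
    using R_valid[OF abR(1) y(1)] abR(2) by (simp add: ab ratio_def field_simps)
  then have "(\<Sum>j\<in>V. c j * y j) = b / a None" using y(2) by (simp add: ab ratio_def)
  moreover have "((\<lambda>j. inverse (a None) * a0 j), inverse (a None) * b) \<in> D"
    using D a0(1) abR(2) unfolding inequality_cone_def by simp
  ultimately show ?thesis using y(1) a0(2) abR(2)
    by (intro exI[of _ y] exI[of _ "\<lambda>j. inverse (a None) * a0 j"] exI[of _ "b / a None"])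
      (simp add: field_simps)
qed

section \<open>Duality for expectations over an ambiguity set\<close>

definition marginal :: "'w set \<Rightarrow> ('w \<Rightarrow> 'p \<Rightarrow> real) \<Rightarrow> ('w \<Rightarrow> real) \<Rightarrow> 'p \<Rightarrow> real" where
  "marginal \<Omega> \<phi> lam p = (\<Sum>\<omega>\<in>\<Omega>. lam \<omega> * \<phi> \<omega> p)"

text \<open>
  Each of the two norms is the largest of several \<open>\<ell>\<^sub>1\<close>-norms of parts of the error vector. The
  parts are the sets in \<open>\<B>\<close>: the whole index set for the \<open>\<ell>\<^sub>1\<close>-norm, the singletons for the
  \<open>\<ell>\<^sub>\<infinity>\<close>-norm.
\<close>

definition within_budgets :: "'p set set \<Rightarrow> ('p \<Rightarrow> real) \<Rightarrow> real \<Rightarrow> ('p \<Rightarrow> real) \<Rightarrow> bool" where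
  "within_budgets \<B> v \<eta> q \<longleftrightarrow> (\<forall>B\<in>\<B>. (\<Sum>p\<in>B. \<bar>q p - v p\<bar>) \<le> \<eta>)"

definition ambiguity_set ::
  "'w set \<Rightarrow> ('w \<Rightarrow> 'p \<Rightarrow> real) \<Rightarrow> 'p set set \<Rightarrow> ('p \<Rightarrow> real) \<Rightarrow> real \<Rightarrow> ('w \<Rightarrow> real) set" where
  "ambiguity_set \<Omega> \<phi> \<B> v \<eta> =
     {lam. (\<forall>\<omega>\<in>\<Omega>. 0 \<le> lam \<omega>) \<and> (\<Sum>\<omega>\<in>\<Omega>. lam \<omega>) = 1 \<and> within_budgets \<B> v \<eta> (marginal \<Omega> \<phi> lam)}"

text \<open>
  The polar of the budget constraints: \<open>\<eta> * (\<Sum>B\<in>\<B>. h B)\<close> bounds the pairing of \<open>\<beta>\<close> with any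
  error vector that respects all budgets.
\<close>

definition dominated :: "'p set \<Rightarrow> 'p set set \<Rightarrow> ('p \<Rightarrow> real) \<Rightarrow> ('p set \<Rightarrow> real) \<Rightarrow> bool" where
  "dominated I \<B> \<beta> h \<longleftrightarrow>
     (\<forall>B\<in>\<B>. 0 \<le> h B) \<and> (\<forall>p\<in>I. \<bar>\<beta> p\<bar> \<le> (\<Sum>B | B \<in> \<B> \<and> p \<in> B. h B))"

text \<open>
  Bounding \<open>\<bar>\<beta> p\<bar>\<close> by the rates of the budgets that contain \<open>p\<close> and exchanging the sums
  charges every error to its budgets. The lemma is stated for arbitrary \<open>q\<close> because it is applied both
  to the marginals of a distribution and to those of a flow.
\<close>

lemma dominated_pairing_le:
  assumes fin: "finite I" "finite \<B>" and sub: "\<And>B. B \<in> \<B> \<Longrightarrow> B \<subseteq> I"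
    and dom: "dominated I \<B> \<beta> h" and q: "within_budgets \<B> v \<eta> q"
  shows "(\<Sum>p\<in>I. \<beta> p * q p) \<le> (\<Sum>p\<in>I. \<beta> p * v p) + \<eta> * (\<Sum>B\<in>\<B>. h B)"
proof -
  have "(\<Sum>p\<in>I. \<beta> p * q p) - (\<Sum>p\<in>I. \<beta> p * v p) = (\<Sum>p\<in>I. \<beta> p * (q p - v p))"
    by (simp add: sum_subtractf right_diff_distrib)
  also have "\<dots> \<le> (\<Sum>p\<in>I. (\<Sum>B | B \<in> \<B> \<and> p \<in> B. h B) * \<bar>q p - v p\<bar>)"
  proof (rule sum_mono)
    fix p assume p: "p \<in> I"
    have "\<beta> p * (q p - v p) \<le> \<bar>\<beta> p\<bar> * \<bar>q p - v p\<bar>" by (metis abs_ge_self abs_mult)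
    also have "\<dots> \<le> (\<Sum>B | B \<in> \<B> \<and> p \<in> B. h B) * \<bar>q p - v p\<bar>"
      using dom p by (intro mult_right_mono) (auto simp: dominated_def)
    finally show "\<beta> p * (q p - v p) \<le> (\<Sum>B | B \<in> \<B> \<and> p \<in> B. h B) * \<bar>q p - v p\<bar>" .
  qed
  also have "\<dots> = (\<Sum>p\<in>I. \<Sum>B | B \<in> \<B> \<and> p \<in> B. h B * \<bar>q p - v p\<bar>)"
    by (simp add: sum_distrib_right)
  also have "\<dots> = (\<Sum>B\<in>\<B>. \<Sum>p | p \<in> I \<and> p \<in> B. h B * \<bar>q p - v p\<bar>)"
    using fin by (rule sum.swap_restrict)
  also have "\<dots> = (\<Sum>B\<in>\<B>. h B * (\<Sum>p\<in>B. \<bar>q p - v p\<bar>))"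
  proof (rule sum.cong[OF refl])
    fix B assume "B \<in> \<B>"
    then have "{p. p \<in> I \<and> p \<in> B} = B" using sub by auto
    then show "(\<Sum>p | p \<in> I \<and> p \<in> B. h B * \<bar>q p - v p\<bar>) = h B * (\<Sum>p\<in>B. \<bar>q p - v p\<bar>)"
      by (simp add: sum_distrib_left)
  qed
  also have "\<dots> \<le> (\<Sum>B\<in>\<B>. h B * \<eta>)"
    using dom q by (intro sum_mono mult_left_mono) (auto simp: dominated_def within_budgets_def)
  also have "\<dots> = \<eta> * (\<Sum>B\<in>\<B>. h B)" by (simp add: sum_distrib_left mult.commute)
  finally show ?thesis by simp
qed

lemma expectation_le_dual_value:
  assumes fin: "finite I" "finite \<B>" and sub: "\<And>B. B \<in> \<B> \<Longrightarrow> B \<subseteq> I"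
    and dom: "dominated I \<B> \<beta> h" and lam: "lam \<in> ambiguity_set \<Omega> \<phi> \<B> v \<eta>"
    and c: "\<And>\<omega>. \<omega> \<in> \<Omega> \<Longrightarrow> c \<omega> \<le> \<gamma> + (\<Sum>p\<in>I. \<beta> p * \<phi> \<omega> p)"
  shows "(\<Sum>\<omega>\<in>\<Omega>. c \<omega> * lam \<omega>) \<le> \<gamma> + (\<Sum>p\<in>I. \<beta> p * v p) + \<eta> * (\<Sum>B\<in>\<B>. h B)"
proof -
  have "(\<Sum>\<omega>\<in>\<Omega>. c \<omega> * lam \<omega>) \<le> (\<Sum>\<omega>\<in>\<Omega>. (\<gamma> + (\<Sum>p\<in>I. \<beta> p * \<phi> \<omega> p)) * lam \<omega>)"
    using lam c by (intro sum_mono mult_right_mono) (auto simp: ambiguity_set_def)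
  also have "\<dots> = \<gamma> * (\<Sum>\<omega>\<in>\<Omega>. lam \<omega>) + (\<Sum>\<omega>\<in>\<Omega>. \<Sum>p\<in>I. \<beta> p * (lam \<omega> * \<phi> \<omega> p))"
    by (simp add: distrib_left sum.distrib sum_distrib_left mult_ac)
  also have "(\<Sum>\<omega>\<in>\<Omega>. \<Sum>p\<in>I. \<beta> p * (lam \<omega> * \<phi> \<omega> p)) = (\<Sum>p\<in>I. \<beta> p * marginal \<Omega> \<phi> lam p)"
    by (subst sum.swap) (simp add: marginal_def sum_distrib_left)
  also have "\<gamma> * (\<Sum>\<omega>\<in>\<Omega>. lam \<omega>) + \<dots> \<le> \<gamma> + ((\<Sum>p\<in>I. \<beta> p * v p) + \<eta> * (\<Sum>B\<in>\<B>. h B))"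
    using dominated_pairing_le[OF fin sub dom] lam by (auto simp: ambiguity_set_def)
  finally show ?thesis by simp
qed

text \<open>
  Expresses a budget by linear inequalities without auxiliary variables. There are exponentially
  many, which is harmless, as they are only used to derive the small dual certificate.
\<close>

lemma sum_abs_le_iff_signs:
  fixes f :: "'p \<Rightarrow> real"
  shows "(\<Sum>p\<in>B. \<bar>f p\<bar>) \<le> K \<longleftrightarrow> (\<forall>s\<in>B \<rightarrow>\<^sub>E {-1, 1}. (\<Sum>p\<in>B. s p * f p) \<le> K)"
proof
  assume K: "(\<Sum>p\<in>B. \<bar>f p\<bar>) \<le> K"
  show "\<forall>s\<in>B \<rightarrow>\<^sub>E {-1, 1}. (\<Sum>p\<in>B. s p * f p) \<le> K"
  proof
    fix s :: "'p \<Rightarrow> real" assume s: "s \<in> B \<rightarrow>\<^sub>E {-1, 1}"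
    have "(\<Sum>p\<in>B. s p * f p) \<le> (\<Sum>p\<in>B. \<bar>f p\<bar>)"
    proof (rule sum_mono)
      fix p assume "p \<in> B"
      then have "s p = -1 \<or> s p = 1" using s by (auto dest: PiE_mem)
      then show "s p * f p \<le> \<bar>f p\<bar>" by auto
    qed
    then show "(\<Sum>p\<in>B. s p * f p) \<le> K" using K by simp
  qed
next
  assume s: "\<forall>s\<in>B \<rightarrow>\<^sub>E {-1, 1}. (\<Sum>p\<in>B. s p * f p) \<le> K"
  define s where "s = restrict (\<lambda>p. if f p < 0 then -1 else 1 :: real) B"
  have "(\<Sum>p\<in>B. \<bar>f p\<bar>) = (\<Sum>p\<in>B. s p * f p)"
    by (intro sum.cong) (auto simp: s_def)
  moreover have "s \<in> B \<rightarrow>\<^sub>E {-1, 1}" by (auto simp: s_def)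
  ultimately show "(\<Sum>p\<in>B. \<bar>f p\<bar>) \<le> K" using s by simp
qed

text \<open>
  Linear programming duality for the expectation over the ambiguity set, whose inequalities are
  nonnegativity, total mass one and the budgets with all sign patterns. Each of them has a
  certificate \<open>(\<gamma>, \<beta>, h)\<close>, and certificates can be added and scaled, so that the certified
  inequalities form a cone.
\<close>

theorem robust_expectation_duality:
  fixes \<phi> :: "'w \<Rightarrow> 'p \<Rightarrow> real"
  assumes \<Omega>: "finite \<Omega>" and fin: "finite I" "finite \<B>" and sub: "\<And>B. B \<in> \<B> \<Longrightarrow> B \<subseteq> I"
    and nonempty: "ambiguity_set \<Omega> \<phi> \<B> v \<eta> \<noteq> {}"
  shows "\<exists>lam \<gamma> \<beta> h. lam \<in> ambiguity_set \<Omega> \<phi> \<B> v \<eta> \<and> dominated I \<B> \<beta> h \<and>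
           (\<forall>\<omega>\<in>\<Omega>. c \<omega> \<le> \<gamma> + (\<Sum>p\<in>I. \<beta> p * \<phi> \<omega> p)) \<and>
           \<gamma> + (\<Sum>p\<in>I. \<beta> p * v p) + \<eta> * (\<Sum>B\<in>\<B>. h B) = (\<Sum>\<omega>\<in>\<Omega>. c \<omega> * lam \<omega>)"
proof -
  have finB: "finite B" if "B \<in> \<B>" for B using sub[OF that] fin(1) by (rule finite_subset)
  define nonneg where "nonneg = (\<lambda>\<omega>. ((\<lambda>\<omega>'. - of_bool (\<omega>' = \<omega>)) :: 'w \<Rightarrow> real, 0 :: real)) ` \<Omega>"
  define total where "total = ({((\<lambda>\<omega>. 1), 1), ((\<lambda>\<omega>. - 1), - 1)} :: (('w \<Rightarrow> real) \<times> real) set)"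
  define budget where "budget = (\<lambda>(B, s). ((\<lambda>\<omega>. \<Sum>p\<in>B. s p * \<phi> \<omega> p), \<eta> + (\<Sum>p\<in>B. s p * v p))) `
     (SIGMA B:\<B>. B \<rightarrow>\<^sub>E {-1, 1})"
  define C where "C = nonneg \<union> total \<union> budget"
  have C_finite: "finite C"
    unfolding C_def nonneg_def total_def budget_def using \<Omega> fin finB
    by (auto intro!: finite_SigmaI finite_PiE)
  have C_iff: "satisfies \<Omega> lam C \<longleftrightarrow> lam \<in> ambiguity_set \<Omega> \<phi> \<B> v \<eta>" for lam
  proof -
    have "satisfies \<Omega> lam nonneg \<longleftrightarrow> (\<forall>\<omega>\<in>\<Omega>. 0 \<le> lam \<omega>)"
      using \<Omega> by (simp add: satisfies_def nonneg_def sum_negf)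
    moreover have "satisfies \<Omega> lam total \<longleftrightarrow> (\<Sum>\<omega>\<in>\<Omega>. lam \<omega>) = 1"
      by (auto simp: satisfies_def total_def sum_negf)
    moreover have "satisfies \<Omega> lam budget \<longleftrightarrow> within_budgets \<B> v \<eta> (marginal \<Omega> \<phi> lam)"
    proof -
      have "(\<Sum>\<omega>\<in>\<Omega>. (\<Sum>p\<in>B. s p * \<phi> \<omega> p) * lam \<omega>) = (\<Sum>p\<in>B. s p * marginal \<Omega> \<phi> lam p)" for B s
        by (simp add: marginal_def sum_distrib_left sum_distrib_right mult_ac) (rule sum.swap)
      then have "(\<Sum>\<omega>\<in>\<Omega>. (\<Sum>p\<in>B. s p * \<phi> \<omega> p) * lam \<omega>) \<le> \<eta> + (\<Sum>p\<in>B. s p * v p) \<longleftrightarrow>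
          (\<Sum>p\<in>B. s p * (marginal \<Omega> \<phi> lam p - v p)) \<le> \<eta>" for B s
        by (simp add: right_diff_distrib sum_subtractf algebra_simps)
      then show ?thesis
        by (simp add: satisfies_def budget_def within_budgets_def sum_abs_le_iff_signs)
    qed
    ultimately show ?thesis
      by (auto simp: ambiguity_set_def C_def satisfies_def)
  qed
  define D where "D = {(a, b). \<exists>\<gamma> \<beta> h. dominated I \<B> \<beta> h \<and>
     (\<forall>\<omega>\<in>\<Omega>. a \<omega> \<le> \<gamma> + (\<Sum>p\<in>I. \<beta> p * \<phi> \<omega> p)) \<and>
     \<gamma> + (\<Sum>p\<in>I. \<beta> p * v p) + \<eta> * (\<Sum>B\<in>\<B>. h B) = b}"
  have DI: "(a, b) \<in> D" if "dominated I \<B> \<beta> h"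
    "\<And>\<omega>. \<omega> \<in> \<Omega> \<Longrightarrow> a \<omega> \<le> \<gamma> + (\<Sum>p\<in>I. \<beta> p * \<phi> \<omega> p)"
    "\<gamma> + (\<Sum>p\<in>I. \<beta> p * v p) + \<eta> * (\<Sum>B\<in>\<B>. h B) = b" for a b \<gamma> \<beta> h
    using that unfolding D_def by blast
  have dominated0: "dominated I \<B> (\<lambda>_. 0) (\<lambda>_. 0)" by (simp add: dominated_def)
  have D_cone: "inequality_cone D"
    unfolding inequality_cone_def
  proof (intro conjI allI impI)
    show "((\<lambda>_. 0), 0) \<in> D" by (rule DI[OF dominated0, of _ 0]) auto
  next
    fix a b a' b' assume "(a, b) \<in> D" "(a', b') \<in> D"
    then obtain \<gamma> \<beta> h \<gamma>' \<beta>' h' where *: "dominated I \<B> \<beta> h" "dominated I \<B> \<beta>' h'"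
      "\<And>\<omega>. \<omega> \<in> \<Omega> \<Longrightarrow> a \<omega> \<le> \<gamma> + (\<Sum>p\<in>I. \<beta> p * \<phi> \<omega> p)"
      "\<And>\<omega>. \<omega> \<in> \<Omega> \<Longrightarrow> a' \<omega> \<le> \<gamma>' + (\<Sum>p\<in>I. \<beta>' p * \<phi> \<omega> p)"
      "\<gamma> + (\<Sum>p\<in>I. \<beta> p * v p) + \<eta> * (\<Sum>B\<in>\<B>. h B) = b"
      "\<gamma>' + (\<Sum>p\<in>I. \<beta>' p * v p) + \<eta> * (\<Sum>B\<in>\<B>. h' B) = b'"
      unfolding D_def by blast
    show "((\<lambda>\<omega>. a \<omega> + a' \<omega>), b + b') \<in> D"
    proof (rule DI[of "\<lambda>p. \<beta> p + \<beta>' p" "\<lambda>B. h B + h' B" _ "\<gamma> + \<gamma>'"])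
      show "dominated I \<B> (\<lambda>p. \<beta> p + \<beta>' p) (\<lambda>B. h B + h' B)"
        using *(1,2) unfolding dominated_def
        by (auto simp: sum.distrib intro!: order.trans[OF abs_triangle_ineq] add_mono)
    qed (use *(3-6) in \<open>force simp: distrib_right distrib_left sum.distrib\<close>)+
  next
    fix t a b assume t: "(0 :: real) \<le> t" and "(a, b) \<in> D"
    then obtain \<gamma> \<beta> h where *: "dominated I \<B> \<beta> h"
      "\<And>\<omega>. \<omega> \<in> \<Omega> \<Longrightarrow> a \<omega> \<le> \<gamma> + (\<Sum>p\<in>I. \<beta> p * \<phi> \<omega> p)"
      "\<gamma> + (\<Sum>p\<in>I. \<beta> p * v p) + \<eta> * (\<Sum>B\<in>\<B>. h B) = b"
      unfolding D_def by blast
    show "((\<lambda>\<omega>. t * a \<omega>), t * b) \<in> D"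
    proof (rule DI[of "\<lambda>p. t * \<beta> p" "\<lambda>B. t * h B" _ "t * \<gamma>"])
      show "dominated I \<B> (\<lambda>p. t * \<beta> p) (\<lambda>B. t * h B)"
        using *(1) t unfolding dominated_def
        by (auto simp: abs_mult sum_distrib_left[symmetric] intro!: mult_left_mono)
      show "t * a \<omega> \<le> t * \<gamma> + (\<Sum>p\<in>I. t * \<beta> p * \<phi> \<omega> p)" if "\<omega> \<in> \<Omega>" for \<omega>
        using mult_left_mono[OF *(2)[OF that] t] by (simp add: distrib_left sum_distrib_left mult.assoc)
      show "t * \<gamma> + (\<Sum>p\<in>I. t * \<beta> p * v p) + \<eta> * (\<Sum>B\<in>\<B>. t * h B) = t * b"
        by (simp add: *(3)[symmetric] distrib_left sum_distrib_left mult_ac)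
    qed
  qed
  have "nonneg \<subseteq> D"
    unfolding nonneg_def by (auto intro!: DI[OF dominated0, of _ 0])
  moreover have "total \<subseteq> D"
    unfolding total_def using DI[OF dominated0, of _ 1] DI[OF dominated0, of _ "-1"] by simp
  moreover have "((\<lambda>\<omega>. \<Sum>p\<in>B. s p * \<phi> \<omega> p), \<eta> + (\<Sum>p\<in>B. s p * v p)) \<in> D"
    if B: "B \<in> \<B>" and s: "s \<in> B \<rightarrow>\<^sub>E {-1, 1}" for B s
  proof (rule DI[of "\<lambda>p. if p \<in> B then s p else 0" "\<lambda>B'. of_bool (B' = B)" _ 0])
    have on_B: "(\<Sum>p\<in>I. (if p \<in> B then s p else 0) * f p) = (\<Sum>p\<in>B. s p * f p)" for f
      using sub[OF B] fin(1) by (intro sum.mono_neutral_cong_right) auto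
    show "(\<Sum>p\<in>B. s p * \<phi> \<omega> p) \<le> 0 + (\<Sum>p\<in>I. (if p \<in> B then s p else 0) * \<phi> \<omega> p)" for \<omega>
      by (simp add: on_B)
    show "0 + (\<Sum>p\<in>I. (if p \<in> B then s p else 0) * v p) + \<eta> * (\<Sum>B'\<in>\<B>. of_bool (B' = B)) =
        \<eta> + (\<Sum>p\<in>B. s p * v p)"
      using B fin(2) by (simp add: on_B)
    have "\<bar>s p\<bar> \<le> (\<Sum>B' | B' \<in> \<B> \<and> p \<in> B'. of_bool (B' = B))" if p: "p \<in> B" for p
    proof -
      have "s p = -1 \<or> s p = 1" using s p by (auto dest: PiE_mem)
      moreover have "(\<Sum>B' | B' \<in> \<B> \<and> p \<in> B'. of_bool (B' = B)) = (1 :: real)"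
        using B p fin(2) by (subst sum.remove[of _ B]) auto
      ultimately show ?thesis by auto
    qed
    then show "dominated I \<B> (\<lambda>p. if p \<in> B then s p else 0) (\<lambda>B'. of_bool (B' = B))"
      unfolding dominated_def by (auto intro!: sum_nonneg)
  qed
  then have "budget \<subseteq> D" unfolding budget_def by auto
  ultimately have CD: "C \<subseteq> D" by (simp add: C_def)
  obtain lam0 where lam0: "satisfies \<Omega> lam0 C" using nonempty C_iff by blast
  have "(\<Sum>\<omega>\<in>\<Omega>. c \<omega> * lam \<omega>) \<le> (\<Sum>\<omega>\<in>\<Omega>. \<bar>c \<omega>\<bar>)" if "satisfies \<Omega> lam C" for lam
  proof (rule sum_mono)
    fix \<omega> assume \<omega>: "\<omega> \<in> \<Omega>"
    have lam: "\<forall>\<omega>\<in>\<Omega>. 0 \<le> lam \<omega>" "(\<Sum>\<omega>\<in>\<Omega>. lam \<omega>) = 1"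
      using that C_iff by (auto simp: ambiguity_set_def)
    then have "lam \<omega> \<le> 1" using member_le_sum[of \<omega> \<Omega> lam] \<omega> \<Omega> by auto
    then have "\<bar>c \<omega>\<bar> * lam \<omega> \<le> \<bar>c \<omega>\<bar>" using lam \<omega> by (simp add: mult_left_le)
    moreover have "c \<omega> * lam \<omega> \<le> \<bar>c \<omega>\<bar> * lam \<omega>" using lam \<omega> by (intro mult_right_mono) auto
    ultimately show "c \<omega> * lam \<omega> \<le> \<bar>c \<omega>\<bar>" by linarith
  qed
  from lp_duality[OF \<Omega> C_finite CD D_cone lam0 this]
  obtain lam a b where lam: "satisfies \<Omega> lam C" "(a, b) \<in> D" "\<forall>\<omega>\<in>\<Omega>. a \<omega> = c \<omega>"
    "b = (\<Sum>\<omega>\<in>\<Omega>. c \<omega> * lam \<omega>)" by blast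
  then show ?thesis using C_iff unfolding D_def by fastforce
qed

section \<open>Rankings and choice paths\<close>

lemma rankings_finite: "finite (rankings n)"
  unfolding rankings_def by (rule finite_permutations) simp

lemma ranking_inj: "\<sigma> \<in> rankings n \<Longrightarrow> inj \<sigma>"
  unfolding rankings_def by (auto dest: permutes_inj)

lemma arg_min_on_ranking:
  assumes "\<sigma> \<in> rankings n" "finite S" "S \<noteq> {}"
  shows "arg_min_on \<sigma> S \<in> S" "j \<in> S \<Longrightarrow> j \<noteq> arg_min_on \<sigma> S \<Longrightarrow> \<sigma> (arg_min_on \<sigma> S) < \<sigma> j"
proof -
  show S: "arg_min_on \<sigma> S \<in> S" using assms arg_min_if_finite by blast
  assume "j \<in> S" "j \<noteq> arg_min_on \<sigma> S"
  then have "\<sigma> (arg_min_on \<sigma> S) \<le> \<sigma> j" "\<sigma> (arg_min_on \<sigma> S) \<noteq> \<sigma> j"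
    using assms arg_min_if_finite(2)[of S \<sigma>] ranking_inj[OF assms(1)]
    by (auto simp: not_less[symmetric] inj_eq)
  then show "\<sigma> (arg_min_on \<sigma> S) < \<sigma> j" by simp
qed

lemma arg_min_on_ranking_eqI:
  assumes "\<sigma> \<in> rankings n" "finite S" "k \<in> S" "\<And>j. j \<in> S \<Longrightarrow> j \<noteq> k \<Longrightarrow> \<sigma> k < \<sigma> j"
  shows "arg_min_on \<sigma> S = k"
  using arg_min_on_ranking[OF assms(1,2)] assms(3,4) by (metis empty_iff order.asym)

text \<open>
  Counts the products with a smaller key, ties being broken by the product number.
\<close>

lemma ranking_sorted_by:
  fixes f :: "nat \<Rightarrow> nat"
  shows "\<exists>\<sigma>\<in>rankings n. \<forall>i\<le>n. \<forall>j\<le>n. f i < f j \<longrightarrow> \<sigma> i < \<sigma> j"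
proof -
  define h where "h = (\<lambda>j. f j * Suc n + j)"
  have h_less: "h i < h j" if "i \<le> n" "f i < f j" for i j
  proof -
    have "h i < Suc (f i) * Suc n" using that(1) by (simp add: h_def)
    also have "\<dots> \<le> f j * Suc n" using that(2) by (intro mult_le_mono1) simp
    finally show ?thesis by (simp add: h_def)
  qed
  have h_eq: "h i \<noteq> h j" if "i \<le> n" "j \<le> n" "i \<noteq> j" for i j
    using h_less[of i j] h_less[of j i] that by (cases "f i" "f j" rule: linorder_cases) (auto simp: h_def)
  define rank where "rank = (\<lambda>j. card {i. i \<le> n \<and> h i < h j})"
  have rank_less: "rank i < rank j" if "i \<le> n" "h i < h j" for i j
    unfolding rank_def using that by (intro psubset_card_mono) auto
  have rank_le: "rank j \<le> n" if "j \<le> n" for j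
  proof -
    have "rank j \<le> card ({..n} - {j})" unfolding rank_def using that by (intro card_mono) auto
    then show ?thesis using that by simp
  qed
  define \<sigma> where "\<sigma> = (\<lambda>j. if j \<le> n then rank j else j)"
  have "inj_on \<sigma> {..n}"
  proof (rule inj_onI)
    fix i j assume ij: "i \<in> {..n}" "j \<in> {..n}" "\<sigma> i = \<sigma> j"
    then have "rank i = rank j" by (simp add: \<sigma>_def)
    then show "i = j" using h_eq[of i j] rank_less[of i j] rank_less[of j i] ij
      by (metis atMost_iff less_irrefl nat_neq_iff)
  qed
  moreover have "\<sigma> ` {..n} \<subseteq> {..n}" using rank_le by (auto simp: \<sigma>_def)
  ultimately have "bij_betw \<sigma> {..n} {..n}" by (simp add: bij_betw_def endo_inj_surj)
  then have "\<sigma> permutes {..n}" by (rule bij_imp_permutes) (simp add: \<sigma>_def)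
  then have "\<sigma> \<in> rankings n" by (simp add: rankings_def)
  moreover have "\<sigma> i < \<sigma> j" if "i \<le> n" "j \<le> n" "f i < f j" for i j
    using that rank_less h_less by (simp add: \<sigma>_def)
  ultimately show ?thesis by blast
qed

text \<open>
  The choices that a ranking makes from growing assortments: a choice is kept until a newly added
  product replaces it.
\<close>

definition choice_path :: "(nat \<Rightarrow> nat set) \<Rightarrow> nat \<Rightarrow> (nat \<Rightarrow> nat) \<Rightarrow> bool" where
  "choice_path A M c \<longleftrightarrow> (\<forall>m\<in>{1..M}. c m \<in> A m) \<and>
     (\<forall>m\<in>{1..<M}. c (Suc m) = c m \<or> c (Suc m) \<notin> A m)"

text \<open>
  If \<open>i\<close> is chosen from \<open>A m\<close> although \<open>k \<in> A m\<close>, then \<open>i\<close> is ranked before \<open>k\<close>, so that \<open>k\<close> cannot be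
  chosen from an assortment that contains \<open>i\<close>.
\<close>

definition blocked :: "(nat \<Rightarrow> nat set) \<Rightarrow> nat \<Rightarrow> nat \<Rightarrow> nat \<Rightarrow> bool" where
  "blocked A k m i \<longleftrightarrow> k \<in> A m \<and> i \<noteq> k"

lemma nested_assortments_mono:
  assumes "nested_assortments n M A" "1 \<le> l" "l \<le> m" "m \<le> M"
  shows "A l \<subseteq> A m"
  using assms(3,4,2)
proof (induction m rule: dec_induct)
  case (step m)
  then have "A m \<subseteq> A (Suc m)" using assms(1) unfolding nested_assortments_def by auto
  then show ?case using step by auto
qed simp

lemma nested_assortment_facts:
  assumes "nested_assortments n M A" "m \<in> {1..M}"
  shows "finite (A m)" "0 \<in> A m" "A m \<subseteq> {..n}"
  using assms finite_subset[of "A m" "{..n}"] unfolding nested_assortments_def assortments_def by blast+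

text \<open>
  If the choice from \<open>A (Suc m)\<close> was available in \<open>A m\<close> but not chosen there, it and the choice from
  \<open>A m\<close> would each be ranked before the other.
\<close>

lemma ranking_choices_path:
  assumes nested: "nested_assortments n M A" and \<sigma>: "\<sigma> \<in> rankings n"
  shows "choice_path A M (\<lambda>m. arg_min_on \<sigma> (A m))"
proof -
  have mem: "arg_min_on \<sigma> (A m) \<in> A m" if "m \<in> {1..M}" for m
    using arg_min_on_ranking(1)[OF \<sigma>] nested_assortment_facts[OF nested that] by blast
  have "arg_min_on \<sigma> (A (Suc m)) = arg_min_on \<sigma> (A m)"
    if m: "m \<in> {1..<M}" and old: "arg_min_on \<sigma> (A (Suc m)) \<in> A m" for m
  proof (rule ccontr)
    let ?i = "arg_min_on \<sigma> (A m)" and ?j = "arg_min_on \<sigma> (A (Suc m))"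
    assume neq: "?j \<noteq> ?i"
    have ms: "m \<in> {1..M}" "Suc m \<in> {1..M}" using m by auto
    have "\<sigma> ?i < \<sigma> ?j"
      using arg_min_on_ranking(2)[OF \<sigma> _ _ old neq] nested_assortment_facts[OF nested ms(1)] by blast
    moreover have "?i \<in> A (Suc m)"
      using mem[OF ms(1)] nested_assortments_mono[OF nested, of m "Suc m"] m by auto
    then have "\<sigma> ?j < \<sigma> ?i"
      using arg_min_on_ranking(2)[OF \<sigma>, of "A (Suc m)" ?i] nested_assortment_facts[OF nested ms(2)] neq by auto
    ultimately show False by simp
  qed
  then show ?thesis using mem unfolding choice_path_def by blast
qed

lemma ranking_choice_not_blocked:
  assumes \<sigma>: "\<sigma> \<in> rankings n" and S: "finite S" "S \<noteq> {}" and Am: "finite (A m)"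
    and blk: "blocked A (arg_min_on \<sigma> S) m (arg_min_on \<sigma> (A m))"
  shows "arg_min_on \<sigma> (A m) \<notin> S"
proof
  let ?k = "arg_min_on \<sigma> S" and ?i = "arg_min_on \<sigma> (A m)"
  assume "?i \<in> S"
  then have "\<sigma> ?k < \<sigma> ?i" using arg_min_on_ranking(2)[OF \<sigma> S] blk by (auto simp: blocked_def)
  moreover have "\<sigma> ?i < \<sigma> ?k"
    using arg_min_on_ranking(2)[OF \<sigma> Am, of ?k] blk by (auto simp: blocked_def)
  ultimately show False by simp
qed

text \<open>
  Products enter a path only when they are new, and \<open>j\<close> is no longer new after layer \<open>l\<close>.
\<close>

lemma choice_path_never_returns:
  assumes nested: "nested_assortments n M A" and c: "choice_path A M c"
    and l: "1 \<le> l" "l \<le> m" "m \<le> M" and j: "j \<in> A l" "c l \<noteq> j"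
  shows "c m \<noteq> j"
  using l(2,3)
proof (induction m rule: dec_induct)
  case (step m)
  then have "j \<in> A m" using nested_assortments_mono[OF nested l(1), of m] j by auto
  moreover have "c (Suc m) = c m \<or> c (Suc m) \<notin> A m"
    using c step l unfolding choice_path_def by auto
  ultimately show ?case using step by auto
qed (use j in simp)

text \<open>
  A ranking is obtained by sorting with a key. Let \<open>f j\<close> count the layers in which \<open>j\<close> is available but
  not chosen; it must be ranked after the choices there. Products on the path are sorted by \<open>f\<close>, the
  product \<open>k\<close> is placed just before the path products with the same count, and products that are
  never chosen come last.
\<close>

theorem choice_path_realizable:
  assumes nested: "nested_assortments n M A" and c: "choice_path A M c"
    and S: "S \<subseteq> {..n}" and k: "k \<in> S"
    and free: "\<And>m. m \<in> {1..M} \<Longrightarrow> blocked A k m (c m) \<Longrightarrow> c m \<notin> S"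
  shows "\<exists>\<sigma>\<in>rankings n. (\<forall>m\<in>{1..M}. arg_min_on \<sigma> (A m) = c m) \<and> arg_min_on \<sigma> S = k"
proof -
  define before where "before = (\<lambda>j. {m \<in> {1..M}. j \<in> A m \<and> c m \<noteq> j})"
  define f where "f = (\<lambda>j. card (before j))"
  \<comment> \<open>Doubling leaves room for \<open>k\<close> between two path products; \<open>2 * M + 2\<close> exceeds all other keys,
    since \<open>f j \<le> M\<close>.\<close>
  define key where "key = (\<lambda>j. if j = k then 2 * f j
     else if j \<in> c ` {1..M} then 2 * f j + 1 else 2 * M + 2)"
  have fin: "finite (before j)" for j by (simp add: before_def)
  have f_le: "f j \<le> M" for j
  proof -
    have "card (before j) \<le> card {1..M}" by (rule card_mono) (auto simp: before_def)
    then show ?thesis by (simp add: f_def)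
  qed
  have cA: "c m \<in> A m" if "m \<in> {1..M}" for m using c that by (auto simp: choice_path_def)
  have key_path: "key (c m) < key j" if m: "m \<in> {1..M}" and j: "j \<in> A m" "j \<noteq> c m" for m j
  proof -
    have "before (c m) \<subseteq> {Suc m..M}"
    proof
      fix l assume l: "l \<in> before (c m)"
      show "l \<in> {Suc m..M}"
      proof (rule ccontr)
        assume "l \<notin> {Suc m..M}"
        then have "l \<le> m" using l by (auto simp: before_def)
        then show False
          using choice_path_never_returns[OF nested c, of l m "c m"] l m by (auto simp: before_def)
      qed
    qed
    then have "f (c m) \<le> M - m" using card_mono[of "{Suc m..M}" "before (c m)"] by (simp add: f_def)
    moreover have "{m..M} \<subseteq> before j"
    proof
      fix l assume l: "l \<in> {m..M}"
      then have "j \<in> A l" using nested_assortments_mono[OF nested, of m l] j m by auto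
      moreover have "c l \<noteq> j" using choice_path_never_returns[OF nested c, of m l j] j m l by auto
      ultimately show "l \<in> before j" using l m by (auto simp: before_def)
    qed
    then have "card {m..M} \<le> f j" unfolding f_def using fin by (intro card_mono)
    then have "Suc (M - m) \<le> f j" using m by (simp add: Suc_diff_le)
    ultimately have "f (c m) < f j" by simp
    then show ?thesis using f_le[of j] f_le[of "c m"] m by (auto simp: key_def)
  qed
  have key_S: "key k < key j" if j: "j \<in> S" "j \<noteq> k" for j
  proof (cases "j \<in> c ` {1..M}")
    case True
    then obtain l where l: "l \<in> {1..M}" "j = c l" by auto
    have "k \<notin> A l" using free[OF l(1)] j l(2) by (auto simp: blocked_def)
    \<comment> \<open>Every layer \<open>m\<close> in \<open>before k\<close> lies after the layer \<open>l\<close> that chooses \<open>j\<close>, as \<open>k \<notin> A l\<close>, and its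
      choice is outside \<open>S\<close>, hence different from \<open>j\<close>.\<close>
    have "before k \<subseteq> before j"
    proof
      fix m assume m: "m \<in> before k"
      then have "c m \<notin> S" using free[of m] by (auto simp: before_def blocked_def)
      moreover have "l \<le> m"
      proof (rule ccontr)
        assume "\<not> l \<le> m"
        then have "A m \<subseteq> A l" using nested_assortments_mono[OF nested, of m l] m l by (auto simp: before_def)
        then show False using m \<open>k \<notin> A l\<close> by (auto simp: before_def)
      qed
      then have "j \<in> A m"
        using nested_assortments_mono[OF nested, of l m] cA[OF l(1)] l m by (auto simp: before_def)
      ultimately show "m \<in> before j" using m j by (auto simp: before_def)
    qed
    then have "f k \<le> f j" unfolding f_def using fin by (intro card_mono)
    then show ?thesis using True j by (simp add: key_def)
  next
    case False
    then show ?thesis using f_le[of k] j by (simp add: key_def)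
  qed
  obtain \<sigma> where \<sigma>: "\<sigma> \<in> rankings n" "\<forall>i\<le>n. \<forall>j\<le>n. key i < key j \<longrightarrow> \<sigma> i < \<sigma> j"
    using ranking_sorted_by by blast
  have "arg_min_on \<sigma> (A m) = c m" if m: "m \<in> {1..M}" for m
  proof (rule arg_min_on_ranking_eqI[OF \<sigma>(1) _ cA[OF m]])
    fix j assume "j \<in> A m" "j \<noteq> c m"
    then show "\<sigma> (c m) < \<sigma> j"
      using \<sigma>(2) key_path[OF m] cA[OF m] nested_assortment_facts(3)[OF nested m] by auto
  qed (use nested_assortment_facts[OF nested m] in simp)
  moreover have "arg_min_on \<sigma> S = k"
    using \<sigma> key_S S k finite_subset[OF S] by (intro arg_min_on_ranking_eqI[OF \<sigma>(1)]) auto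
  ultimately show ?thesis using \<sigma>(1) by blast
qed

section \<open>Potentials and flows on the layered graph of choices\<close>

definition succs :: "(nat \<Rightarrow> nat set) \<Rightarrow> nat \<Rightarrow> nat \<Rightarrow> nat set" where
  "succs A m i = {j \<in> A (Suc m). j = i \<or> j \<notin> A m}"

definition preds :: "(nat \<Rightarrow> nat set) \<Rightarrow> nat \<Rightarrow> nat \<Rightarrow> nat set" where
  "preds A m j = {i \<in> A m. j = i \<or> j \<notin> A m}"

text \<open>
  Potentials dominate the weight of every path that ends in a node, so that bounding them in the
  last layer bounds exponentially many paths by polynomially many inequalities.
\<close>

definition is_potential ::
  "(nat \<Rightarrow> nat set) \<Rightarrow> nat \<Rightarrow> (nat \<Rightarrow> nat \<Rightarrow> real) \<Rightarrow> (nat \<Rightarrow> nat \<Rightarrow> real) \<Rightarrow> bool" where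
  "is_potential A M w \<pi> \<longleftrightarrow> (\<forall>i\<in>A 1. w 1 i \<le> \<pi> 1 i) \<and>
     (\<forall>m\<in>{1..<M}. \<forall>i\<in>A m. \<forall>j\<in>succs A m i. \<pi> m i + w (Suc m) j \<le> \<pi> (Suc m) j)"

lemma choice_path_Suc:
  "choice_path A (Suc M) c \<longleftrightarrow> choice_path A M c \<and> c (Suc M) \<in> A (Suc M) \<and>
     (1 \<le> M \<longrightarrow> c (Suc M) \<in> succs A M (c M))"
  unfolding choice_path_def succs_def
  by (auto simp: atLeastAtMostSuc_conv atLeastLessThanSuc)

lemma potential_bounds_paths:
  assumes \<pi>: "is_potential A M w \<pi>" and c: "choice_path A m c" and m: "1 \<le> m" "m \<le> M"
  shows "(\<Sum>l=1..m. w l (c l)) \<le> \<pi> m (c m)"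
  using m c
proof (induction m rule: dec_induct)
  case base
  then show ?case using \<pi> by (simp add: is_potential_def choice_path_def)
next
  case (step m)
  then have "(\<Sum>l=1..m. w l (c l)) \<le> \<pi> m (c m)" by (simp add: choice_path_Suc)
  moreover have "\<pi> m (c m) + w (Suc m) (c (Suc m)) \<le> \<pi> (Suc m) (c (Suc m))"
    using \<pi> step by (auto simp: is_potential_def choice_path_Suc) (auto simp: choice_path_def)
  ultimately show ?case by simp
qed

text \<open>
  The potentials are the weights of longest paths, computed layer by layer. The paths that attain
  them show that potentials can be as small as the path weights allow.
\<close>

lemma longest_path_potential:
  assumes fin: "\<And>m. m \<in> {1..M} \<Longrightarrow> finite (A m)" and M: "1 \<le> M"
    and preds: "\<And>m j. m \<in> {1..<M} \<Longrightarrow> j \<in> A (Suc m) \<Longrightarrow> preds A m j \<noteq> {}"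
  shows "\<exists>\<pi>. is_potential A M w \<pi> \<and>
     (\<forall>j\<in>A M. \<exists>c. choice_path A M c \<and> c M = j \<and> (\<Sum>m=1..M. w m (c m)) = \<pi> M j)"
proof -
  define \<pi> where "\<pi> = rec_nat (\<lambda>_. 0) (\<lambda>m p j. w (Suc m) j + (if m = 0 then 0 else Max (p ` preds A m j)))"
  have \<pi>_1: "\<pi> (Suc 0) j = w (Suc 0) j" for j by (simp add: \<pi>_def)
  have \<pi>_Suc: "\<pi> (Suc m) j = w (Suc m) j + Max (\<pi> m ` preds A m j)" if "1 \<le> m" for m j
    using that by (simp add: \<pi>_def)
  have finp: "finite (preds A m j)" if "m \<in> {1..<M}" for m j
    using fin[of m] that by (auto simp: preds_def)
  have "is_potential A M w \<pi>"
    unfolding is_potential_def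
  proof (intro conjI ballI)
    fix m i j assume m: "m \<in> {1..<M}" and ij: "i \<in> A m" "j \<in> succs A m i"
    then have "\<pi> m i \<le> Max (\<pi> m ` preds A m j)"
      using finp[OF m] by (intro Max_ge) (auto simp: preds_def succs_def)
    then show "\<pi> m i + w (Suc m) j \<le> \<pi> (Suc m) j" using m by (simp add: \<pi>_Suc)
  qed (simp add: \<pi>_1)
  moreover have "\<exists>c. choice_path A m c \<and> c m = j \<and> (\<Sum>l=1..m. w l (c l)) = \<pi> m j"
    if "j \<in> A m" "1 \<le> m" "m \<le> M" for m j
    using that(2,3,1)
  proof (induction m arbitrary: j rule: dec_induct)
    case base
    then show ?case by (intro exI[of _ "\<lambda>_. j"]) (simp add: choice_path_def \<pi>_1)
  next
    case (step m)
    then have m: "m \<in> {1..<M}" by simp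
    then have "Max (\<pi> m ` preds A m j) \<in> \<pi> m ` preds A m j"
      using finp preds step by (intro Max_in) auto
    then obtain i where i: "i \<in> preds A m j" "\<pi> m i = Max (\<pi> m ` preds A m j)" by auto
    then obtain c where c: "choice_path A m c" "c m = i" "(\<Sum>l=1..m. w l (c l)) = \<pi> m i"
      using step.IH[of i] step by (auto simp: preds_def)
    define c' where "c' = c(Suc m := j)"
    have "choice_path A m c'" using c(1) by (auto simp: choice_path_def c'_def)
    then have "choice_path A (Suc m) c'"
      using i(1) step c(2) by (auto simp: choice_path_Suc c'_def succs_def preds_def)
    moreover have "(\<Sum>l=1..m. w l (c' l)) = \<pi> m i"
      unfolding c(3)[symmetric] by (intro sum.cong) (auto simp: c'_def)
    then have "(\<Sum>l=1..Suc m. w l (c' l)) = \<pi> (Suc m) j"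
      using step i(2) by (simp add: \<pi>_Suc c'_def)
    moreover have "c' (Suc m) = j" by (simp add: c'_def)
    ultimately show ?case by blast
  qed
  ultimately show ?thesis using M by blast
qed

definition layered_flow ::
  "(nat \<Rightarrow> nat set) \<Rightarrow> nat \<Rightarrow> (nat \<Rightarrow> nat \<Rightarrow> real) \<Rightarrow> (nat \<Rightarrow> nat \<Rightarrow> nat \<Rightarrow> real) \<Rightarrow> bool" where
  "layered_flow A M F E \<longleftrightarrow>
     (\<forall>m\<in>{1..M}. \<forall>i\<in>A m. 0 \<le> F m i) \<and>
     (\<forall>m\<in>{1..<M}. \<forall>i\<in>A m. \<forall>j\<in>succs A m i. 0 \<le> E m i j) \<and>
     (\<forall>m\<in>{1..<M}. \<forall>i\<in>A m. F m i = (\<Sum>j\<in>succs A m i. E m i j)) \<and>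
     (\<forall>m\<in>{1..<M}. \<forall>j\<in>A (Suc m). F (Suc m) j = (\<Sum>i\<in>preds A m j. E m i j))"

lemma sum_edges_swap:
  assumes "finite (A m)" "finite (A (Suc m))"
  shows "(\<Sum>i\<in>A m. \<Sum>j\<in>succs A m i. f i j) = (\<Sum>j\<in>A (Suc m). \<Sum>i\<in>preds A m j. f i j)"
  unfolding succs_def preds_def using assms by (rule sum.swap_restrict)

text \<open>
  In each layer, the flow-weighted potential grows by at least the weight that the flow collects,
  because potentials grow along each edge by at least the weight of its end.
\<close>

lemma flow_weight_le_potential:
  assumes fin: "\<And>m. m \<in> {1..M} \<Longrightarrow> finite (A m)" and flow: "layered_flow A M F E"
    and \<pi>: "is_potential A M w \<pi>" and m: "1 \<le> m" "m \<le> M"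
  shows "(\<Sum>l=1..m. \<Sum>i\<in>A l. F l i * w l i) \<le> (\<Sum>i\<in>A m. F m i * \<pi> m i)"
  using m
proof (induction m rule: dec_induct)
  case base
  then show ?case using \<pi> flow m
    by (auto simp: is_potential_def layered_flow_def intro!: sum_mono mult_left_mono)
next
  case (step m)
  then have m: "m \<in> {1..<M}" by simp
  have fin2: "finite (A m)" "finite (A (Suc m))" using fin m by auto
  have "(\<Sum>i\<in>A m. F m i * \<pi> m i) + (\<Sum>j\<in>A (Suc m). F (Suc m) j * w (Suc m) j) =
      (\<Sum>i\<in>A m. \<Sum>j\<in>succs A m i. E m i j * \<pi> m i) +
      (\<Sum>j\<in>A (Suc m). \<Sum>i\<in>preds A m j. E m i j * w (Suc m) j)"
    using flow m by (simp add: layered_flow_def sum_distrib_right)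
  also have "\<dots> = (\<Sum>i\<in>A m. \<Sum>j\<in>succs A m i. E m i j * (\<pi> m i + w (Suc m) j))"
    by (simp add: sum_edges_swap[OF fin2, symmetric] sum.distrib distrib_left)
  also have "\<dots> \<le> (\<Sum>i\<in>A m. \<Sum>j\<in>succs A m i. E m i j * \<pi> (Suc m) j)"
    using flow \<pi> m by (intro sum_mono mult_left_mono) (auto simp: layered_flow_def is_potential_def)
  also have "\<dots> = (\<Sum>j\<in>A (Suc m). F (Suc m) j * \<pi> (Suc m) j)"
    using flow m by (simp add: sum_edges_swap[OF fin2] layered_flow_def sum_distrib_right)
  finally show ?case using step by simp
qed

text \<open>
  A bound for all paths carries over to flows as if the flow were a mixture of paths, without
  decomposing it.
\<close>

lemma flow_weight_le_path_bound:
  assumes fin: "\<And>m. m \<in> {1..M} \<Longrightarrow> finite (A m)" and M: "1 \<le> M"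
    and preds: "\<And>m j. m \<in> {1..<M} \<Longrightarrow> j \<in> A (Suc m) \<Longrightarrow> preds A m j \<noteq> {}"
    and flow: "layered_flow A M F E"
    and bound: "\<And>c. choice_path A M c \<Longrightarrow> (\<Sum>m=1..M. w m (c m)) \<le> K"
  shows "(\<Sum>m=1..M. \<Sum>i\<in>A m. F m i * w m i) \<le> K * (\<Sum>i\<in>A M. F M i)"
proof -
  obtain \<pi> where \<pi>: "is_potential A M w \<pi>"
    "\<And>j. j \<in> A M \<Longrightarrow> \<exists>c. choice_path A M c \<and> c M = j \<and> (\<Sum>m=1..M. w m (c m)) = \<pi> M j"
    using longest_path_potential[OF fin M preds] by blast
  have le: "\<pi> M j \<le> K" if "j \<in> A M" for j using \<pi>(2)[OF that] bound by metis
  have "(\<Sum>m=1..M. \<Sum>i\<in>A m. F m i * w m i) \<le> (\<Sum>i\<in>A M. F M i * \<pi> M i)"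
    by (rule flow_weight_le_potential[OF fin flow \<pi>(1) M]) auto
  also have "\<dots> \<le> (\<Sum>i\<in>A M. F M i * K)"
    using flow M le by (intro sum_mono mult_left_mono) (auto simp: layered_flow_def)
  finally show ?thesis by (simp add: sum_distrib_left mult.commute)
qed

lemma nested_assortments_preds:
  assumes "nested_assortments n M A" "m \<in> {1..<M}" "j \<in> A (Suc m)"
  shows "preds A m j \<noteq> {}"
  using nested_assortment_facts(2)[OF assms(1), of m] assms(2) unfolding preds_def by auto

section \<open>Linear systems as problem schemes\<close>

datatype data = Data (revs: "nat \<Rightarrow> real") (sales: "nat \<Rightarrow> nat \<Rightarrow> real") (radius: real) (target: real)

text \<open>
  The numbers that an affine form can express; forms are handled only through their values.
\<close>

definition coefficient :: "nat \<Rightarrow> nat \<Rightarrow> (data \<Rightarrow> real) \<Rightarrow> bool" where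
  "coefficient n M a \<longleftrightarrow> (\<exists>f. \<forall>r v \<eta> \<theta>. eval_form n M r v \<eta> \<theta> f = a (Data r v \<eta> \<theta>))"

lemma coefficientI:
  fixes c :: real and n :: nat and a :: "nat \<Rightarrow> real" and M :: nat
    and b :: "nat \<Rightarrow> nat \<Rightarrow> real" and p q :: real
  assumes "\<And>r v \<eta> \<theta>. c + (\<Sum>i\<le>n. a i * r i) + (\<Sum>m=1..M. \<Sum>i\<le>n. b m i * v m i) + p * \<eta> + q * \<theta>
    = g (Data r v \<eta> \<theta>)"
  shows "coefficient n M g"
  unfolding coefficient_def using assms by (intro exI[of _ "Affine c a b p q"]) simp

lemma coefficient_const: "coefficient n M (\<lambda>_. c)"
  by (rule coefficientI[of c "\<lambda>_. 0" n "\<lambda>_ _. 0" M 0 0]) simp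

lemma coefficient_revs: "i \<le> n \<Longrightarrow> coefficient n M (\<lambda>d. revs d i)"
  by (rule coefficientI[of 0 "\<lambda>j. of_bool (j = i)" n "\<lambda>_ _. 0" M 0 0])
    (simp add: of_bool_def if_distrib[of "\<lambda>x. x * _"] cong: if_cong)

lemma coefficient_sales:
  assumes "m \<in> {1..M}" "i \<le> n" shows "coefficient n M (\<lambda>d. sales d m i)"
proof (rule coefficientI[of 0 "\<lambda>_. 0" n "\<lambda>m' i'. of_bool (m' = m) * of_bool (i' = i)" M 0 0])
  fix r :: "nat \<Rightarrow> real" and v :: "nat \<Rightarrow> nat \<Rightarrow> real" and \<eta> \<theta> :: real
  have "(\<Sum>m'=1..M. \<Sum>i'\<le>n. of_bool (m' = m) * of_bool (i' = i) * v m' i') =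
      (\<Sum>m'=1..M. if m' = m then (\<Sum>i'\<le>n. if i' = i then v m' i' else 0) else 0)"
    by (intro sum.cong refl) (auto intro!: sum.cong)
  also have "\<dots> = v m i" using assms by simp
  finally show "0 + (\<Sum>i\<le>n. 0 * r i) + (\<Sum>m'=1..M. \<Sum>i'\<le>n. of_bool (m' = m) * of_bool (i' = i) * v m' i')
      + 0 * \<eta> + 0 * \<theta> = sales (Data r v \<eta> \<theta>) m i"
    by simp
qed

lemma coefficient_radius: "coefficient n M radius"
  by (rule coefficientI[of 0 "\<lambda>_. 0" n "\<lambda>_ _. 0" M 1 0]) simp

lemma coefficient_target: "coefficient n M target"
  by (rule coefficientI[of 0 "\<lambda>_. 0" n "\<lambda>_ _. 0" M 0 1]) simp

lemma coefficient_add: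
  assumes "coefficient n M a" "coefficient n M b"
  shows "coefficient n M (\<lambda>d. a d + b d)"
proof -
  obtain f g where fg: "\<And>r v \<eta> \<theta>. eval_form n M r v \<eta> \<theta> f = a (Data r v \<eta> \<theta>)"
    "\<And>r v \<eta> \<theta>. eval_form n M r v \<eta> \<theta> g = b (Data r v \<eta> \<theta>)"
    using assms unfolding coefficient_def by blast
  obtain c1 a1 b1 p1 q1 c2 a2 b2 p2 q2 where "f = Affine c1 a1 b1 p1 q1" "g = Affine c2 a2 b2 p2 q2"
    by (metis affine_form.exhaust)
  then show ?thesis
    by (intro coefficientI[of "c1 + c2" "\<lambda>i. a1 i + a2 i" n "\<lambda>m i. b1 m i + b2 m i" M "p1 + p2" "q1 + q2"])
      (simp add: fg[symmetric] distrib_right sum.distrib)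
qed

lemma coefficient_scale:
  assumes "coefficient n M a" shows "coefficient n M (\<lambda>d. t * a d)"
proof -
  obtain f where f: "\<And>r v \<eta> \<theta>. eval_form n M r v \<eta> \<theta> f = a (Data r v \<eta> \<theta>)"
    using assms unfolding coefficient_def by blast
  obtain c1 a1 b1 p1 q1 where "f = Affine c1 a1 b1 p1 q1"
    by (metis affine_form.exhaust)
  then show ?thesis
    by (intro coefficientI[of "t * c1" "\<lambda>i. t * a1 i" n "\<lambda>m i. t * b1 m i" M "t * p1" "t * q1"])
      (simp add: f[symmetric] distrib_left sum_distrib_left mult.assoc)
qed

lemma coefficient_uminus: "coefficient n M a \<Longrightarrow> coefficient n M (\<lambda>d. - a d)"
  using coefficient_scale[of n M a "-1"] by simp

lemma coefficient_diff:
  "coefficient n M a \<Longrightarrow> coefficient n M b \<Longrightarrow> coefficient n M (\<lambda>d. a d - b d)"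
  using coefficient_add[OF _ coefficient_uminus, of n M a b] by simp

type_synonym 'j expr = "data \<Rightarrow> (nat \<Rightarrow> real) \<Rightarrow> ('j \<Rightarrow> real) \<Rightarrow> real"

text \<open>
  Variables are indexed by a set \<open>J\<close> of any type, which spares numbering them by hand; the translation to
  indices \<open>1, 2, \<dots>\<close> is left to \<open>linear_system_milp\<close>.
\<close>

definition linear_expr :: "nat \<Rightarrow> nat \<Rightarrow> 'j set \<Rightarrow> 'j expr \<Rightarrow> bool" where
  "linear_expr n M J L \<longleftrightarrow> (\<exists>b c a. (\<forall>i. coefficient n M (b i)) \<and> (\<forall>j. coefficient n M (c j)) \<and>
     coefficient n M a \<and>
     (\<forall>d x y. L d x y = (\<Sum>i=1..n. b i d * x i) + (\<Sum>j\<in>J. c j d * y j) + a d))"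

lemma linear_exprI:
  assumes "\<And>i. coefficient n M (b i)" "\<And>j. coefficient n M (c j)" "coefficient n M a"
    "\<And>d x y. L d x y = (\<Sum>i=1..n. b i d * x i) + (\<Sum>j\<in>J. c j d * y j) + a d"
  shows "linear_expr n M J L"
  unfolding linear_expr_def using assms by blast

lemma linear_expr_coefficient:
  "coefficient n M a \<Longrightarrow> linear_expr n M J (\<lambda>d x y. a d)"
  by (rule linear_exprI[of n M "\<lambda>_ _. 0" "\<lambda>_ _. 0" a]) (auto intro: coefficient_const)

lemma linear_expr_binary:
  assumes "i \<in> {1..n}" "coefficient n M a"
  shows "linear_expr n M J (\<lambda>d x y. a d * x i)"
proof (rule linear_exprI[of n M "\<lambda>i' d. of_bool (i' = i) * a d" "\<lambda>_ _. 0" "\<lambda>_. 0"])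
  fix d :: data and x :: "nat \<Rightarrow> real" and y :: "'a \<Rightarrow> real"
  have "(\<Sum>i'=1..n. of_bool (i' = i) * a d * x i') = (\<Sum>i'=1..n. if i' = i then a d * x i' else 0)"
    by (intro sum.cong) auto
  then show "a d * x i = (\<Sum>i'=1..n. of_bool (i' = i) * a d * x i') + (\<Sum>j\<in>J. 0 * y j) + 0"
    using assms(1) by simp
qed (auto intro: coefficient_const coefficient_scale assms)

lemma linear_expr_continuous:
  assumes "finite J" "j \<in> J" "coefficient n M a"
  shows "linear_expr n M J (\<lambda>d x y. a d * y j)"
proof (rule linear_exprI[of n M "\<lambda>_ _. 0" "\<lambda>j' d. of_bool (j' = j) * a d" "\<lambda>_. 0"])
  fix d :: data and x :: "nat \<Rightarrow> real" and y :: "'a \<Rightarrow> real"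
  have "(\<Sum>j'\<in>J. of_bool (j' = j) * a d * y j') = (\<Sum>j'\<in>J. if j' = j then a d * y j' else 0)"
    by (intro sum.cong) auto
  then show "a d * y j = (\<Sum>i=1..n. 0 * x i) + (\<Sum>j'\<in>J. of_bool (j' = j) * a d * y j') + 0"
    using assms by simp
qed (auto intro: coefficient_const coefficient_scale assms)

lemma linear_expr_add:
  assumes "linear_expr n M J L" "linear_expr n M J L'"
  shows "linear_expr n M J (\<lambda>d x y. L d x y + L' d x y)"
proof -
  obtain b c a b' c' a' where *: "\<And>i. coefficient n M (b i)" "\<And>j. coefficient n M (c j)" "coefficient n M a"
    "\<And>d x y. L d x y = (\<Sum>i=1..n. b i d * x i) + (\<Sum>j\<in>J. c j d * y j) + a d"
    "\<And>i. coefficient n M (b' i)" "\<And>j. coefficient n M (c' j)" "coefficient n M a'"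
    "\<And>d x y. L' d x y = (\<Sum>i=1..n. b' i d * x i) + (\<Sum>j\<in>J. c' j d * y j) + a' d"
    using assms unfolding linear_expr_def by blast
  show ?thesis
    by (rule linear_exprI[of n M "\<lambda>i d. b i d + b' i d" "\<lambda>j d. c j d + c' j d" "\<lambda>d. a d + a' d"])
      (simp_all add: * coefficient_add distrib_right sum.distrib)
qed

lemma linear_expr_uminus:
  assumes "linear_expr n M J L"
  shows "linear_expr n M J (\<lambda>d x y. - L d x y)"
proof -
  obtain b c a where *: "\<And>i. coefficient n M (b i)" "\<And>j. coefficient n M (c j)" "coefficient n M a"
    "\<And>d x y. L d x y = (\<Sum>i=1..n. b i d * x i) + (\<Sum>j\<in>J. c j d * y j) + a d"
    using assms unfolding linear_expr_def by blast
  show ?thesis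
    by (rule linear_exprI[of n M "\<lambda>i d. - b i d" "\<lambda>j d. - c j d" "\<lambda>d. - a d"])
      (simp_all add: * coefficient_uminus sum_negf)
qed

lemma linear_expr_diff:
  "linear_expr n M J L \<Longrightarrow> linear_expr n M J L' \<Longrightarrow> linear_expr n M J (\<lambda>d x y. L d x y - L' d x y)"
  using linear_expr_add[OF _ linear_expr_uminus, of n M J L L'] by simp

lemma linear_expr_sum:
  assumes "\<And>q. q \<in> Q \<Longrightarrow> linear_expr n M J (L q)"
  shows "linear_expr n M J (\<lambda>d x y. \<Sum>q\<in>Q. L q d x y)"
  using assms
proof (induction Q rule: infinite_finite_induct)
  case (insert q Q)
  then show ?case using linear_expr_add[of n M J "L q"] by simp
qed (simp_all add: linear_expr_coefficient coefficient_const)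

lemma linear_expr_variable: "finite J \<Longrightarrow> j \<in> J \<Longrightarrow> linear_expr n M J (\<lambda>d x y. y j)"
  using linear_expr_continuous[of J j n M "\<lambda>_. 1"] by (simp add: coefficient_const)

text \<open>
  The number of constraints is part of the notion, so that the closure lemmas derive the size bound
  along the structure of a formula.
\<close>

definition linear_system ::
  "nat \<Rightarrow> nat \<Rightarrow> 'j set \<Rightarrow> nat \<Rightarrow> (data \<Rightarrow> (nat \<Rightarrow> real) \<Rightarrow> ('j \<Rightarrow> real) \<Rightarrow> bool) \<Rightarrow> bool" where
  "linear_system n M J N P \<longleftrightarrow> (\<exists>K. finite K \<and> card K \<le> N \<and> (\<forall>L\<in>K. linear_expr n M J L) \<and>
     (\<forall>d x y. P d x y \<longleftrightarrow> (\<forall>L\<in>K. L d x y \<le> 0)))"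

lemma linear_system_le:
  assumes "linear_expr n M J L" "linear_expr n M J L'"
  shows "linear_system n M J 1 (\<lambda>d x y. L d x y \<le> L' d x y)"
  unfolding linear_system_def using linear_expr_diff[OF assms]
  by (intro exI[of _ "{\<lambda>d x y. L d x y - L' d x y}"]) auto

lemma linear_system_conj:
  assumes "linear_system n M J N P" "linear_system n M J N' P'"
  shows "linear_system n M J (N + N') (\<lambda>d x y. P d x y \<and> P' d x y)"
proof -
  obtain K K' where *: "finite K" "card K \<le> N" "\<forall>L\<in>K. linear_expr n M J L"
     "\<And>d x y. P d x y \<longleftrightarrow> (\<forall>L\<in>K. L d x y \<le> 0)"
     "finite K'" "card K' \<le> N'" "\<forall>L\<in>K'. linear_expr n M J L"
     "\<And>d x y. P' d x y \<longleftrightarrow> (\<forall>L\<in>K'. L d x y \<le> 0)"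
    using assms unfolding linear_system_def by blast
  have "card (K \<union> K') \<le> N + N'" using card_Un_le[of K K'] *(2,6) by simp
  then show ?thesis unfolding linear_system_def using *
    by (intro exI[of _ "K \<union> K'"]) (simp add: ball_Un)
qed

lemma linear_system_eq:
  assumes "linear_expr n M J L" "linear_expr n M J L'"
  shows "linear_system n M J 2 (\<lambda>d x y. L d x y = L' d x y)"
proof -
  have "linear_system n M J (1 + 1) (\<lambda>d x y. L d x y \<le> L' d x y \<and> L' d x y \<le> L d x y)"
    using assms by (intro linear_system_conj linear_system_le)
  moreover have "(\<lambda>d x y. L d x y \<le> L' d x y \<and> L' d x y \<le> L d x y) = (\<lambda>d x y. L d x y = L' d x y)"
    by (intro ext) auto
  ultimately show ?thesis by (simp only: one_add_one)
qed

lemma linear_system_abs_le: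
  assumes "linear_expr n M J L" "linear_expr n M J L'"
  shows "linear_system n M J 2 (\<lambda>d x y. \<bar>L d x y\<bar> \<le> L' d x y)"
proof -
  have "linear_system n M J (1 + 1) (\<lambda>d x y. L d x y \<le> L' d x y \<and> - L d x y \<le> L' d x y)"
    using assms by (intro linear_system_conj linear_system_le linear_expr_uminus)
  then show ?thesis by (simp only: one_add_one abs_le_iff)
qed

lemma linear_system_ball:
  assumes "finite Q" "card Q \<le> k" "\<And>q. q \<in> Q \<Longrightarrow> linear_system n M J N (P q)"
  shows "linear_system n M J (k * N) (\<lambda>d x y. \<forall>q\<in>Q. P q d x y)"
proof -
  define system where "system = (\<lambda>q K. finite K \<and> card K \<le> N \<and> (\<forall>L\<in>K. linear_expr n M J L) \<and>
     (\<forall>d x y. P q d x y \<longleftrightarrow> (\<forall>L\<in>K. L d x y \<le> 0)))"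
  have "\<forall>q\<in>Q. \<exists>K. system q K" using assms(3) unfolding linear_system_def system_def by blast
  then obtain K where "\<forall>q\<in>Q. system q (K q)" by metis
  then have K: "\<And>q. q \<in> Q \<Longrightarrow> finite (K q) \<and> card (K q) \<le> N \<and> (\<forall>L\<in>K q. linear_expr n M J L) \<and>
     (\<forall>d x y. P q d x y \<longleftrightarrow> (\<forall>L\<in>K q. L d x y \<le> 0))"
    unfolding system_def by blast
  have "card (\<Union>q\<in>Q. K q) \<le> (\<Sum>q\<in>Q. card (K q))" using assms(1) by (rule card_UN_le)
  also have "\<dots> \<le> card Q * N" 
    using sum_bounded_above[of Q "\<lambda>q. card (K q)" N] K by simp
  also have "\<dots> \<le> k * N" using assms(2) by (rule mult_le_mono1)
  finally show ?thesis unfolding linear_system_def using K assms(1)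
    by (intro exI[of _ "\<Union>q\<in>Q. K q"]) auto
qed

lemma linear_system_imp:
  assumes "b \<Longrightarrow> linear_system n M J N P"
  shows "linear_system n M J N (\<lambda>d x y. b \<longrightarrow> P d x y)"
proof (cases b)
  case False
  then show ?thesis unfolding linear_system_def by (intro exI[of _ "{}"]) auto
qed (use assms in simp)

lemma linear_system_mono:
  assumes "linear_system n M J N P" "N \<le> N'"
  shows "linear_system n M J N' P"
proof -
  obtain K where "finite K" "card K \<le> N" "\<forall>L\<in>K. linear_expr n M J L"
     "\<forall>d x y. P d x y \<longleftrightarrow> (\<forall>L\<in>K. L d x y \<le> 0)"
    using assms(1) unfolding linear_system_def by blast
  then show ?thesis unfolding linear_system_def using assms(2) by (intro exI[of _ K] conjI) simp_all
qed

lemma linear_expr_cong: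
  assumes "linear_expr n M J L" "\<And>j. j \<in> J \<Longrightarrow> y j = y' j"
  shows "L d x y = L d x y'"
proof -
  obtain b c a where "\<And>d x y. L d x y = (\<Sum>i=1..n. b i d * x i) + (\<Sum>j\<in>J. c j d * y j) + a d"
    using assms(1) unfolding linear_expr_def by blast
  then show ?thesis using assms(2) by simp
qed

lemma linear_system_cong:
  assumes "linear_system n M J N P" "\<And>j. j \<in> J \<Longrightarrow> y j = y' j"
  shows "P d x y = P d x y'"
proof -
  obtain K where K: "\<forall>L\<in>K. linear_expr n M J L" "\<And>d x y. P d x y \<longleftrightarrow> (\<forall>L\<in>K. L d x y \<le> 0)"
    using assms(1) unfolding linear_system_def by blast
  have "(\<forall>L\<in>K. L d x y \<le> 0) \<longleftrightarrow> (\<forall>L\<in>K. L d x y' \<le> 0)"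
  proof (rule ball_cong[OF refl])
    fix L assume "L \<in> K"
    then have "L d x y = L d x y'"
      using linear_expr_cong[of n M J L y y' d x] K(1) assms(2) by blast
    then show "L d x y \<le> 0 \<longleftrightarrow> L d x y' \<le> 0" by simp
  qed
  then show ?thesis by (simp only: K(2))
qed

text \<open>
  A scheme can only maximize a linear form without constant term. It suffices to maximize a single
  variable \<open>t\<close>, as the system may bound \<open>t\<close> by the intended objective. The injection \<open>e\<close> numbers the
  variables.
\<close>

theorem linear_system_milp:
  assumes J: "finite J" "t \<in> J" and P: "linear_system n M J N P"
  shows "\<exists>T e. num_bin T = n \<and> num_cont T = card J \<and> num_con T \<le> N \<and> inj_on e J \<and>
     (\<forall>r v \<eta> \<theta> x y.
        ((x, y) \<in> milp_feasible (instantiate n M r v \<eta> \<theta> T) \<longleftrightarrow>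
           (\<forall>i\<in>{1..n}. x i \<in> {0, 1}) \<and> P (Data r v \<eta> \<theta>) x (\<lambda>j. y (e j))) \<and>
        milp_objective (instantiate n M r v \<eta> \<theta> T) (x, y) = y (e t))"
proof -
  obtain K where K: "finite K" "card K \<le> N" "\<And>L. L \<in> K \<Longrightarrow> linear_expr n M J L"
     "\<And>d x y. P d x y \<longleftrightarrow> (\<forall>L\<in>K. L d x y \<le> 0)"
    using P unfolding linear_system_def by blast
  define represents where "represents = (\<lambda>L b c a. (\<forall>i. coefficient n M (b i)) \<and>
     (\<forall>j. coefficient n M (c j)) \<and> coefficient n M a \<and>
     (\<forall>d x y. L d x y = (\<Sum>i=1..n. b i d * x i) + (\<Sum>j\<in>J. c j d * y j) + a d))"
  have "\<forall>L\<in>K. \<exists>b c a. represents L b c a"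
    using K(3) unfolding linear_expr_def represents_def by blast
  then obtain b c a where "\<forall>L\<in>K. represents L (b L) (c L) (a L)" by metis
  then have bca: "\<And>L i. L \<in> K \<Longrightarrow> coefficient n M (b L i)"
    "\<And>L j. L \<in> K \<Longrightarrow> coefficient n M (c L j)"
    "\<And>L. L \<in> K \<Longrightarrow> coefficient n M (a L)"
    "\<And>L d x y. L \<in> K \<Longrightarrow> L d x y = (\<Sum>i=1..n. b L i d * x i) + (\<Sum>j\<in>J. c L j d * y j) + a L d"
    unfolding represents_def by blast+
  define form where "form = (\<lambda>g. SOME f. \<forall>r v \<eta> \<theta>. eval_form n M r v \<eta> \<theta> f = g (Data r v \<eta> \<theta>))"
  have form: "eval_form n M r v \<eta> \<theta> (form g) = g (Data r v \<eta> \<theta>)" if "coefficient n M g" for g r v \<eta> \<theta>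
    using someI_ex[OF that[unfolded coefficient_def]] unfolding form_def by blast
  obtain e where e: "bij_betw e J {1..card J}"
    using bij_betw_inv[of _ "{1..card J}" J] ex_bij_betw_nat_finite_1[OF J(1)] by blast
  obtain k where k: "bij_betw k {1..card K} K" using ex_bij_betw_nat_finite_1[OF K(1)] by blast
  let ?var = "inv_into J e"
  define T where "T = MILP n (card J) (card K) (\<lambda>_. form (\<lambda>_. 0))
     (\<lambda>j. form (\<lambda>_. of_bool (j = e t)))
     (\<lambda>l i. form (b (k l) i)) (\<lambda>l j. form (c (k l) (?var j))) (\<lambda>l. form (\<lambda>d. - a (k l) d))"
  have kK: "k l \<in> K" if "l \<in> {1..card K}" for l using k that by (auto simp: bij_betw_def)
  have reindex: "(\<Sum>j=1..card J. f (?var j) * y j) = (\<Sum>j\<in>J. f j * y (e j))" for f y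
  proof -
    have "(\<Sum>j\<in>J. f (?var (e j)) * y (e j)) = (\<Sum>j=1..card J. f (?var j) * y j)"
      using sum.reindex_bij_betw[OF e, of "\<lambda>i. f (?var i) * y i"] .
    moreover have "(\<Sum>j\<in>J. f (?var (e j)) * y (e j)) = (\<Sum>j\<in>J. f j * y (e j))"
      using e by (intro sum.cong) (auto simp: bij_betw_def)
    ultimately show ?thesis by simp
  qed
  have "(x, y) \<in> milp_feasible (instantiate n M r v \<eta> \<theta> T) \<longleftrightarrow>
      (\<forall>i\<in>{1..n}. x i \<in> {0, 1}) \<and> P (Data r v \<eta> \<theta>) x (\<lambda>j. y (e j))" for r v \<eta> \<theta> x y
  proof -
    let ?d = "Data r v \<eta> \<theta>"
    let ?ev = "eval_form n M r v \<eta> \<theta>"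
    have "(x, y) \<in> milp_feasible (instantiate n M r v \<eta> \<theta> T) \<longleftrightarrow> (\<forall>i\<in>{1..n}. x i \<in> {0, 1}) \<and>
      (\<forall>l\<in>{1..card K}. (\<Sum>i=1..n. ?ev (form (b (k l) i)) * x i) +
         (\<Sum>j=1..card J. ?ev (form (c (k l) (?var j))) * y j) \<le> ?ev (form (\<lambda>d. - a (k l) d)))"
      by (simp add: milp_feasible_def instantiate_def T_def)
    also have "(\<forall>l\<in>{1..card K}. (\<Sum>i=1..n. ?ev (form (b (k l) i)) * x i) +
         (\<Sum>j=1..card J. ?ev (form (c (k l) (?var j))) * y j) \<le> ?ev (form (\<lambda>d. - a (k l) d)))
       \<longleftrightarrow> (\<forall>l\<in>{1..card K}. k l ?d x (\<lambda>j. y (e j)) \<le> 0)"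
    proof (rule ball_cong[OF refl])
      fix l assume "l \<in> {1..card K}"
      note l = kK[OF this]
      have le_iff: "u \<le> - w \<longleftrightarrow> u + w \<le> 0" for u w :: real by linarith
      have "?ev (form (b (k l) i)) = b (k l) i ?d" for i using bca(1)[OF l] by (rule form)
      moreover have "?ev (form (c (k l) j)) = c (k l) j ?d" for j using bca(2)[OF l] by (rule form)
      moreover have "?ev (form (\<lambda>d. - a (k l) d)) = - a (k l) ?d"
        using coefficient_uminus[OF bca(3)[OF l]] by (rule form)
      moreover have "k l ?d x (\<lambda>j. y (e j)) =
          (\<Sum>i=1..n. b (k l) i ?d * x i) + (\<Sum>j=1..card J. c (k l) (?var j) ?d * y j) + a (k l) ?d"
        using bca(4)[OF l, of ?d x "\<lambda>j. y (e j)"] reindex[of "\<lambda>j. c (k l) j ?d" y] by (simp only:)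
      ultimately show "(\<Sum>i=1..n. ?ev (form (b (k l) i)) * x i) +
          (\<Sum>j=1..card J. ?ev (form (c (k l) (?var j))) * y j) \<le> ?ev (form (\<lambda>d. - a (k l) d))
         \<longleftrightarrow> k l ?d x (\<lambda>j. y (e j)) \<le> 0" by (simp only: le_iff)
    qed
    also have "\<dots> \<longleftrightarrow> (\<forall>L\<in>k ` {1..card K}. L ?d x (\<lambda>j. y (e j)) \<le> 0)" by simp
    also have "\<dots> \<longleftrightarrow> P ?d x (\<lambda>j. y (e j))" by (simp only: bij_betw_imp_surj_on[OF k] K(4))
    finally show ?thesis .
  qed
  moreover have "milp_objective (instantiate n M r v \<eta> \<theta> T) (x, y) = y (e t)" for r v \<eta> \<theta> x y
  proof -
    have t: "e t \<in> {1..card J}" using e J(2) by (auto simp: bij_betw_def)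
    have ev: "eval_form n M r v \<eta> \<theta> (form (\<lambda>_. c)) = c" for c
      using form[OF coefficient_const] by simp
    have "milp_objective (instantiate n M r v \<eta> \<theta> T) (x, y) = (\<Sum>j=1..card J. of_bool (j = e t) * y j)"
      by (simp add: milp_objective_def instantiate_def T_def ev)
    also have "\<dots> = (\<Sum>j=1..card J. if j = e t then y j else 0)" by (intro sum.cong) auto
    finally show ?thesis using t by simp
  qed
  ultimately have "\<forall>r v \<eta> \<theta> x y.
        ((x, y) \<in> milp_feasible (instantiate n M r v \<eta> \<theta> T) \<longleftrightarrow>
           (\<forall>i\<in>{1..n}. x i \<in> {0, 1}) \<and> P (Data r v \<eta> \<theta>) x (\<lambda>j. y (e j))) \<and>
        milp_objective (instantiate n M r v \<eta> \<theta> T) (x, y) = y (e t)"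
    by (intro allI conjI)
  moreover have "num_bin T = n" "num_cont T = card J" "num_con T \<le> N"
    using K(2) by (simp_all add: T_def)
  moreover have "inj_on e J" using e by (simp add: bij_betw_def)
  ultimately show ?thesis by (intro exI[of _ T] exI[of _ e] conjI)
qed

section \<open>Certificates for the worst and the best case\<close>

definition budgets :: "norm_kind \<Rightarrow> 'p set \<Rightarrow> 'p set set" where
  "budgets nk I = (case nk of L1 \<Rightarrow> {I} | Linf \<Rightarrow> (\<lambda>p. {p}) ` I)"

text \<open>
  The index set of the sales data and of the error vector.
\<close>

definition cells :: "nat \<Rightarrow> (nat \<Rightarrow> nat set) \<Rightarrow> (nat \<times> nat) set" where
  "cells M A = (SIGMA m:{1..M}. A m)"

definition hits :: "(nat \<Rightarrow> nat set) \<Rightarrow> (nat \<Rightarrow> nat) \<Rightarrow> nat \<times> nat \<Rightarrow> real" where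
  "hits A \<sigma> p = of_bool (snd p = arg_min_on \<sigma> (A (fst p)))"

lemma err_norm_le_iff:
  assumes "finite I" "I \<noteq> {}"
  shows "err_norm nk I e \<le> \<eta> \<longleftrightarrow> (\<forall>B\<in>budgets nk I. (\<Sum>p\<in>B. \<bar>e p\<bar>) \<le> \<eta>)"
  using assms by (cases nk) (auto simp: budgets_def)

lemma budgets_subset: "B \<in> budgets nk I \<Longrightarrow> B \<subseteq> I"
  by (cases nk) (auto simp: budgets_def)

lemma budgets_finite: "finite I \<Longrightarrow> finite (budgets nk I)"
  by (cases nk) (auto simp: budgets_def)

lemma card_budgets_le: "finite I \<Longrightarrow> I \<noteq> {} \<Longrightarrow> card (budgets nk I) \<le> card I"
  by (cases nk) (auto simp: budgets_def card_image_le Suc_le_eq card_gt_0_iff)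

lemma cells_finite: "nested_assortments n M A \<Longrightarrow> finite (cells M A)"
  unfolding cells_def using nested_assortment_facts(1) by (intro finite_SigmaI) auto

lemma sum_cells:
  assumes "nested_assortments n M A"
  shows "(\<Sum>p\<in>cells M A. f p) = (\<Sum>m=1..M. \<Sum>i\<in>A m. f (m, i))"
  unfolding cells_def using nested_assortment_facts(1)[OF assms]
  by (subst sum.Sigma) auto

lemma sum_hits:
  assumes nested: "nested_assortments n M A" and \<sigma>: "\<sigma> \<in> rankings n"
  shows "(\<Sum>p\<in>cells M A. \<beta> p * hits A \<sigma> p) = (\<Sum>m=1..M. \<beta> (m, arg_min_on \<sigma> (A m)))"
  unfolding sum_cells[OF nested]
proof (rule sum.cong[OF refl])
  fix m assume m: "m \<in> {1..M}"
  let ?i = "arg_min_on \<sigma> (A m)"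
  have Am: "finite (A m)" "?i \<in> A m"
    using nested_assortment_facts[OF nested m] arg_min_on_ranking(1)[OF \<sigma>] by auto
  have "(\<Sum>i\<in>A m. \<beta> (m, i) * hits A \<sigma> (m, i)) = (\<Sum>i\<in>A m. if i = ?i then \<beta> (m, i) else 0)"
    by (intro sum.cong) (auto simp: hits_def)
  then show "(\<Sum>i\<in>A m. \<beta> (m, i) * hits A \<sigma> (m, i)) = \<beta> (m, ?i)" using Am by simp
qed

abbreviation ranking_ambiguity ::
  "nat \<Rightarrow> nat \<Rightarrow> (nat \<Rightarrow> nat set) \<Rightarrow> norm_kind \<Rightarrow> (nat \<Rightarrow> nat \<Rightarrow> real) \<Rightarrow> real
    \<Rightarrow> ((nat \<Rightarrow> nat) \<Rightarrow> real) set" where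
  "ranking_ambiguity n M A nk v \<eta> \<equiv>
     ambiguity_set (rankings n) (hits A) (budgets nk (cells M A)) (\<lambda>p. v (fst p) (snd p)) \<eta>"

lemma marginal_hits: "marginal (rankings n) (hits A) lam p = choice_prob n lam (snd p) (A (fst p))"
  by (simp add: marginal_def hits_def choice_prob_def mult.commute)

text \<open>
  The error vector in the definition of the uncertainty set is determined on \<open>cells M A\<close> by the
  distribution, and the norm sees only these entries.
\<close>

lemma uncertainty_set_eq_ranking_ambiguity:
  assumes nested: "nested_assortments n M A" and M: "1 \<le> M"
  shows "uncertainty_set n M A nk v \<eta> = ranking_ambiguity n M A nk v \<eta>"
proof -
  let ?I = "cells M A"
  have "(1, 0) \<in> ?I" using nested_assortment_facts(2)[OF nested, of 1] M by (simp add: cells_def)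
  then have I: "finite ?I" "?I \<noteq> {}" using cells_finite[OF nested] by auto
  have "(\<exists>e. err_norm nk ?I e \<le> \<eta> \<and>
        (\<forall>m\<in>{1..M}. \<forall>i\<in>A m. choice_prob n lam i (A m) - v m i = e (m, i))) \<longleftrightarrow>
      within_budgets (budgets nk ?I) (\<lambda>p. v (fst p) (snd p)) \<eta> (marginal (rankings n) (hits A) lam)" for lam
  proof -
    let ?e = "\<lambda>p. choice_prob n lam (snd p) (A (fst p)) - v (fst p) (snd p)"
    have "err_norm nk ?I e \<le> \<eta> \<longleftrightarrow> err_norm nk ?I ?e \<le> \<eta>"
      if "\<forall>m\<in>{1..M}. \<forall>i\<in>A m. choice_prob n lam i (A m) - v m i = e (m, i)" for e
    proof -
      have "(\<Sum>p\<in>B. \<bar>e p\<bar>) = (\<Sum>p\<in>B. \<bar>?e p\<bar>)" if "B \<in> budgets nk ?I" for B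
        using budgets_subset[OF that] \<open>\<forall>m\<in>{1..M}. _\<close> by (intro sum.cong) (auto simp: cells_def)
      then show ?thesis unfolding err_norm_le_iff[OF I] by simp
    qed
    note same_norm = this
    have "(\<exists>e. err_norm nk ?I e \<le> \<eta> \<and>
        (\<forall>m\<in>{1..M}. \<forall>i\<in>A m. choice_prob n lam i (A m) - v m i = e (m, i))) \<longleftrightarrow>
      err_norm nk ?I ?e \<le> \<eta>"
    proof
      show "err_norm nk ?I ?e \<le> \<eta>" if "\<exists>e. err_norm nk ?I e \<le> \<eta> \<and>
          (\<forall>m\<in>{1..M}. \<forall>i\<in>A m. choice_prob n lam i (A m) - v m i = e (m, i))"
        using that same_norm by blast
    qed (intro exI[of _ ?e], simp)
    then show ?thesis by (simp add: err_norm_le_iff[OF I] within_budgets_def marginal_hits)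
  qed
  then show ?thesis
    unfolding uncertainty_set_def ambiguity_set_def ranking_distributions_def cells_def[symmetric]
    by auto
qed

definition mass :: "nat \<Rightarrow> ((nat \<Rightarrow> nat) \<Rightarrow> real) \<Rightarrow> ((nat \<Rightarrow> nat) \<Rightarrow> bool) \<Rightarrow> real" where
  "mass n lam Q = (\<Sum>\<sigma>\<in>rankings n. lam \<sigma> * of_bool (Q \<sigma>))"

lemma mass_nonneg: "lam \<in> ranking_distributions n \<Longrightarrow> 0 \<le> mass n lam Q"
  unfolding mass_def ranking_distributions_def by (intro sum_nonneg) auto

lemma mass_le_1:
  assumes "lam \<in> ranking_distributions n" shows "mass n lam Q \<le> 1"
proof -
  have "mass n lam Q \<le> (\<Sum>\<sigma>\<in>rankings n. lam \<sigma>)"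
    unfolding mass_def using assms by (intro sum_mono) (auto simp: ranking_distributions_def)
  then show ?thesis using assms by (simp add: ranking_distributions_def)
qed

lemma mass_True: "lam \<in> ranking_distributions n \<Longrightarrow> mass n lam (\<lambda>_. True) = 1"
  by (simp add: mass_def ranking_distributions_def)

lemma mass_cong: "(\<And>\<sigma>. \<sigma> \<in> rankings n \<Longrightarrow> Q \<sigma> = R \<sigma>) \<Longrightarrow> mass n lam Q = mass n lam R"
  unfolding mass_def by (intro sum.cong) auto

text \<open>
  Splitting an event by the value of \<open>f\<close>. All flow equations below are instances.
\<close>

lemma mass_partition_weighted:
  assumes "finite T" "\<And>\<sigma>. \<sigma> \<in> rankings n \<Longrightarrow> Q \<sigma> \<Longrightarrow> f \<sigma> \<in> T"
  shows "(\<Sum>t\<in>T. g t * mass n lam (\<lambda>\<sigma>. Q \<sigma> \<and> f \<sigma> = t)) =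
    (\<Sum>\<sigma>\<in>rankings n. g (f \<sigma>) * lam \<sigma> * of_bool (Q \<sigma>))"
proof -
  have "(\<Sum>t\<in>T. g t * mass n lam (\<lambda>\<sigma>. Q \<sigma> \<and> f \<sigma> = t)) =
      (\<Sum>\<sigma>\<in>rankings n. \<Sum>t\<in>T. g t * (lam \<sigma> * of_bool (Q \<sigma> \<and> f \<sigma> = t)))"
    by (simp add: mass_def sum_distrib_left) (rule sum.swap)
  also have "\<dots> = (\<Sum>\<sigma>\<in>rankings n. g (f \<sigma>) * lam \<sigma> * of_bool (Q \<sigma>))"
  proof (rule sum.cong[OF refl])
    fix \<sigma> assume \<sigma>: "\<sigma> \<in> rankings n"
    have "(\<Sum>t\<in>T. g t * (lam \<sigma> * of_bool (Q \<sigma> \<and> f \<sigma> = t))) =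
        (\<Sum>t\<in>T. if t = f \<sigma> then g (f \<sigma>) * lam \<sigma> * of_bool (Q \<sigma>) else 0)"
      by (intro sum.cong) auto
    also have "\<dots> = g (f \<sigma>) * lam \<sigma> * of_bool (Q \<sigma>)"
      using assms \<sigma> by auto
    finally show "(\<Sum>t\<in>T. g t * (lam \<sigma> * of_bool (Q \<sigma> \<and> f \<sigma> = t))) = g (f \<sigma>) * lam \<sigma> * of_bool (Q \<sigma>)" .
  qed
  finally show ?thesis .
qed

lemma mass_partition:
  assumes "finite T" "\<And>\<sigma>. \<sigma> \<in> rankings n \<Longrightarrow> Q \<sigma> \<Longrightarrow> f \<sigma> \<in> T"
  shows "(\<Sum>t\<in>T. mass n lam (\<lambda>\<sigma>. Q \<sigma> \<and> f \<sigma> = t)) = mass n lam Q"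
  using mass_partition_weighted[OF assms, where g = "\<lambda>_. 1"] by (simp add: mass_def)

lemma assortment_facts: "S \<in> assortments n \<Longrightarrow> finite S \<and> S \<noteq> {} \<and> S \<subseteq> {..n}"
  unfolding assortments_def using finite_subset[of S "{..n}"] by auto

lemma revenue_eq_expectation:
  assumes S: "S \<in> assortments n"
  shows "revenue n r lam S = (\<Sum>\<sigma>\<in>rankings n. r (arg_min_on \<sigma> S) * lam \<sigma>)"
proof -
  have "arg_min_on \<sigma> S \<in> {..n}" if "\<sigma> \<in> rankings n" for \<sigma>
    using arg_min_on_ranking(1)[OF that] assortment_facts[OF S] by blast
  moreover have "choice_prob n lam i S = mass n lam (\<lambda>\<sigma>. True \<and> arg_min_on \<sigma> S = i)" for i
    by (simp add: choice_prob_def mass_def mult.commute eq_commute)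
  ultimately show ?thesis
    unfolding revenue_def
    using mass_partition_weighted[of "{..n}" n "\<lambda>_. True" "\<lambda>\<sigma>. arg_min_on \<sigma> S" r lam] by simp
qed

lemma valid_revenues_bounds:
  assumes "valid_revenues n r" "i \<le> n"
  shows "0 \<le> r i" "r i \<le> r n"
proof -
  have step: "r j \<le> r (Suc j)" if "j < n" for j using assms(1) that by (auto simp: valid_revenues_def intro: less_imp_le)
  have mono: "r j \<le> r l" if "j \<le> l" "l \<le> n" for j l
    using that
  proof (induction l rule: dec_induct)
    case (step l)
    then show ?case using \<open>\<And>j. j < n \<Longrightarrow> r j \<le> r (Suc j)\<close>[of l] by simp
  qed simp
  show "0 \<le> r i" using mono[of 0 i] assms by (simp add: valid_revenues_def)
  show "r i \<le> r n" using mono[of i n] assms by simp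
qed

text \<open>
  Optimal multipliers of the worst case together with the potentials that prove their feasibility.
  With \<open>X\<close> the indicator of the assortment, a product \<open>k\<close> outside it is treated as if it earned
  \<open>revs d n\<close>, and blocked nodes cost \<open>revs d n\<close> each. The terms are linear in \<open>X\<close> and not multiplied by
  any of the continuous unknowns.
\<close>

definition guarantee_certificate ::
  "nat \<Rightarrow> nat \<Rightarrow> (nat \<Rightarrow> nat set) \<Rightarrow> norm_kind \<Rightarrow> data \<Rightarrow> (nat \<Rightarrow> real) \<Rightarrow>
   real \<Rightarrow> (nat \<times> nat \<Rightarrow> real) \<Rightarrow> ((nat \<times> nat) set \<Rightarrow> real) \<Rightarrow> (nat \<Rightarrow> nat \<Rightarrow> nat \<Rightarrow> real) \<Rightarrow> bool" where
  "guarantee_certificate n M A nk d X \<gamma> \<beta> h \<pi> \<longleftrightarrow>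
     dominated (cells M A) (budgets nk (cells M A)) \<beta> h \<and>
     \<gamma> + (\<Sum>p\<in>cells M A. sales d (fst p) (snd p) * \<beta> p) + (\<Sum>B\<in>budgets nk (cells M A). radius d * h B)
       \<le> - target d \<and>
     (\<forall>k\<in>{..n}. is_potential A M
        (\<lambda>m i. - \<beta> (m, i) - (if blocked A k m i then revs d n * X i else 0)) (\<pi> k)) \<and>
     (\<forall>k\<in>{..n}. \<forall>i\<in>A M. \<pi> k M i \<le> \<gamma> + revs d n - (revs d n - revs d k) * X k)"

text \<open>
  \<open>F k\<close> and \<open>E k\<close> are the node and edge flows of the customers who buy \<open>k\<close>. With \<open>X\<close> the indicator of the
  assortment, the capacities \<open>1 - X i\<close> and \<open>X k\<close> keep the flow away from choices inside the assortment
  that rule out \<open>k\<close>, and from purchases outside it.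
\<close>

definition optimism_certificate ::
  "nat \<Rightarrow> nat \<Rightarrow> (nat \<Rightarrow> nat set) \<Rightarrow> norm_kind \<Rightarrow> data \<Rightarrow> (nat \<Rightarrow> real) \<Rightarrow>
   (nat \<Rightarrow> nat \<Rightarrow> nat \<Rightarrow> real) \<Rightarrow> (nat \<Rightarrow> nat \<Rightarrow> nat \<Rightarrow> nat \<Rightarrow> real) \<Rightarrow> (nat \<times> nat \<Rightarrow> real) \<Rightarrow> real \<Rightarrow> bool" where
  "optimism_certificate n M A nk d X F E w t \<longleftrightarrow>
     (\<forall>k\<in>{..n}. layered_flow A M (F k) (E k)) \<and>
     (\<forall>k\<in>{..n}. \<forall>m\<in>{1..M}. \<forall>i\<in>A m. blocked A k m i \<longrightarrow> F k m i \<le> 1 - X i) \<and>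
     (\<forall>k\<in>{..n}. (\<Sum>i\<in>A M. F k M i) \<le> X k) \<and>
     (\<Sum>k\<le>n. \<Sum>i\<in>A M. F k M i) = 1 \<and>
     (\<forall>p\<in>cells M A. \<bar>(\<Sum>k\<le>n. F k (fst p) (snd p)) - sales d (fst p) (snd p)\<bar> \<le> w p) \<and>
     (\<forall>B\<in>budgets nk (cells M A). (\<Sum>p\<in>B. w p) \<le> radius d) \<and>
     t \<le> (\<Sum>k\<le>n. \<Sum>i\<in>A M. revs d k * F k M i)"

context
  fixes n M :: nat and A :: "nat \<Rightarrow> nat set" and nk :: norm_kind and d :: data
    and S :: "nat set" and X :: "nat \<Rightarrow> real"
  assumes nested: "nested_assortments n M A" and M: "1 \<le> M" and S: "S \<in> assortments n"
    and X: "\<And>i. i \<le> n \<Longrightarrow> X i = of_bool (i \<in> S)"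
begin

private abbreviation (input) "U \<equiv> ranking_ambiguity n M A nk (sales d) (radius d)"
private abbreviation (input) "purchase \<equiv> \<lambda>\<sigma> :: nat \<Rightarrow> nat. arg_min_on \<sigma> S"

lemma purchase_mem: "\<sigma> \<in> rankings n \<Longrightarrow> purchase \<sigma> \<in> S \<and> purchase \<sigma> \<le> n"
  using arg_min_on_ranking(1)[of \<sigma> n S] assortment_facts[OF S] by auto

lemma choice_path_mem:
  assumes "choice_path A M c" "m \<in> {1..M}" shows "c m \<in> A m" "c m \<le> n"
  using assms nested_assortment_facts(3)[OF nested assms(2)] unfolding choice_path_def by auto

lemma purchase_not_blocked:
  assumes "\<sigma> \<in> rankings n" "m \<in> {1..M}" "blocked A (purchase \<sigma>) m (arg_min_on \<sigma> (A m))"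
  shows "arg_min_on \<sigma> (A m) \<notin> S"
  using ranking_choice_not_blocked[OF assms(1) _ _ _ assms(3)] assortment_facts[OF S]
    nested_assortment_facts(1)[OF nested assms(2)] by blast

text \<open>
  The instance of duality in which the scenarios are rankings and the observed events are the past
  choices.
\<close>

lemma ranking_duality:
  assumes U: "U \<noteq> {}"
  shows "\<exists>lam \<gamma> \<beta> h. lam \<in> U \<and> dominated (cells M A) (budgets nk (cells M A)) \<beta> h \<and>
    (\<forall>\<sigma>\<in>rankings n. c \<sigma> \<le> \<gamma> + (\<Sum>p\<in>cells M A. \<beta> p * hits A \<sigma> p)) \<and>
    \<gamma> + (\<Sum>p\<in>cells M A. \<beta> p * sales d (fst p) (snd p)) +
      radius d * (\<Sum>B\<in>budgets nk (cells M A). h B) = (\<Sum>\<sigma>\<in>rankings n. c \<sigma> * lam \<sigma>)"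
proof (rule robust_expectation_duality[OF rankings_finite cells_finite[OF nested]
      budgets_finite[OF cells_finite[OF nested]] _ U])
  show "B \<subseteq> cells M A" if "B \<in> budgets nk (cells M A)" for B using that by (rule budgets_subset)
qed

text \<open>
  For the path and the purchase of an actual ranking all penalties vanish, and the potentials give
  the dual inequality of that ranking.
\<close>

lemma guarantee_certificate_sound:
  assumes cert: "guarantee_certificate n M A nk d X \<gamma> \<beta> h \<pi>" and lam: "lam \<in> U"
  shows "target d \<le> revenue n (revs d) lam S"
proof -
  let ?r = "revs d"
  have "- ?r (purchase \<sigma>) \<le> \<gamma> + (\<Sum>p\<in>cells M A. \<beta> p * hits A \<sigma> p)" if \<sigma>: "\<sigma> \<in> rankings n" for \<sigma>
  proof -
    let ?k = "purchase \<sigma>" and ?c = "\<lambda>m. arg_min_on \<sigma> (A m)"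
    note k = purchase_mem[OF \<sigma>]
    note c = ranking_choices_path[OF nested \<sigma>]
    have "- \<beta> (m, ?c m) = - \<beta> (m, ?c m) - (if blocked A ?k m (?c m) then ?r n * X (?c m) else 0)"
      if m: "m \<in> {1..M}" for m
      using purchase_not_blocked[OF \<sigma> m] X[OF choice_path_mem(2)[OF c m]] by auto
    then have "(\<Sum>m=1..M. - \<beta> (m, ?c m)) =
        (\<Sum>m=1..M. - \<beta> (m, ?c m) - (if blocked A ?k m (?c m) then ?r n * X (?c m) else 0))"
      by (intro sum.cong) auto
    also have "\<dots> \<le> \<pi> ?k M (?c M)"
      using potential_bounds_paths[OF _ c M order_refl] cert k unfolding guarantee_certificate_def by blast
    also have "\<dots> \<le> \<gamma> + ?r n - (?r n - ?r ?k) * X ?k"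
      using cert k choice_path_mem(1)[OF c, of M] M unfolding guarantee_certificate_def by auto
    finally show ?thesis using X[of ?k] k by (simp add: sum_hits[OF nested \<sigma>] sum_negf)
  qed
  then have "(\<Sum>\<sigma>\<in>rankings n. - ?r (purchase \<sigma>) * lam \<sigma>) \<le> \<gamma> +
      (\<Sum>p\<in>cells M A. \<beta> p * sales d (fst p) (snd p)) + radius d * (\<Sum>B\<in>budgets nk (cells M A). h B)"
    using cert lam cells_finite[OF nested] budgets_finite[OF cells_finite[OF nested]]
    unfolding guarantee_certificate_def
    by (intro expectation_le_dual_value[where I = "cells M A"]) (auto dest: budgets_subset)
  also have "\<dots> \<le> - target d"
    using cert unfolding guarantee_certificate_def by (simp add: mult.commute sum_distrib_left)
  finally show ?thesis by (simp add: revenue_eq_expectation[OF S] sum_negf)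
qed

text \<open>
  The multipliers come from duality for the negated revenue, the potentials from longest paths. It
  remains to bound all paths. If \<open>k\<close> is in the assortment and the path avoids blocked nodes of the
  assortment, this is the dual inequality of a ranking. Otherwise the bound \<open>\<gamma> + revs d n\<close>, which holds
  for all paths, suffices: it is the right-hand side if \<open>k\<close> is not in the assortment, and a blocked
  node subtracts a penalty of \<open>revs d n\<close>.
\<close>

lemma guarantee_certificate_complete:
  assumes r: "valid_revenues n (revs d)" and U: "U \<noteq> {}"
    and guarantee: "\<And>lam. lam \<in> U \<Longrightarrow> target d \<le> revenue n (revs d) lam S"
  shows "\<exists>\<gamma> \<beta> h \<pi>. guarantee_certificate n M A nk d X \<gamma> \<beta> h \<pi>"
proof -
  let ?r = "revs d"
  obtain lam \<gamma> \<beta> h where lam: "lam \<in> U" and dom: "dominated (cells M A) (budgets nk (cells M A)) \<beta> h"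
    and dual: "\<forall>\<sigma>\<in>rankings n. - ?r (purchase \<sigma>) \<le> \<gamma> + (\<Sum>p\<in>cells M A. \<beta> p * hits A \<sigma> p)"
    and val: "\<gamma> + (\<Sum>p\<in>cells M A. \<beta> p * sales d (fst p) (snd p)) +
        radius d * (\<Sum>B\<in>budgets nk (cells M A). h B) = (\<Sum>\<sigma>\<in>rankings n. - ?r (purchase \<sigma>) * lam \<sigma>)"
    using ranking_duality[OF U, where c = "\<lambda>\<sigma>. - ?r (purchase \<sigma>)"] by blast
  have path: "(\<Sum>m=1..M. - \<beta> (m, c m) - (if blocked A k m (c m) then ?r n * X (c m) else 0))
      \<le> \<gamma> + ?r n - (?r n - ?r k) * X k" (is "_ \<le> ?K") if k: "k \<le> n" and c: "choice_path A M c" for k c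
  proof -
    note rk = valid_revenues_bounds[OF r k]
    define pen where "pen = (\<lambda>m. if blocked A k m (c m) then ?r n * X (c m) else 0)"
    have rn: "0 \<le> ?r n" using valid_revenues_bounds[OF r, of n] by simp
    have pen_nonneg: "0 \<le> pen m" if "m \<in> {1..M}" for m
      using rn X[OF choice_path_mem(2)[OF c that]] by (simp add: pen_def)
    have realized: "(\<Sum>m=1..M. - \<beta> (m, c m)) \<le> \<gamma> + ?r (purchase \<sigma>)"
      if \<sigma>: "\<sigma> \<in> rankings n" "\<forall>m\<in>{1..M}. arg_min_on \<sigma> (A m) = c m" for \<sigma>
    proof -
      have "- ?r (purchase \<sigma>) \<le> \<gamma> + (\<Sum>m=1..M. \<beta> (m, arg_min_on \<sigma> (A m)))"
        using bspec[OF dual \<sigma>(1)] by (simp add: sum_hits[OF nested \<sigma>(1)])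
      also have "(\<Sum>m=1..M. \<beta> (m, arg_min_on \<sigma> (A m))) = (\<Sum>m=1..M. \<beta> (m, c m))"
        using \<sigma>(2) by (intro sum.cong) auto
      finally show ?thesis by (simp add: sum_negf)
    qed
    have weak: "(\<Sum>m=1..M. - \<beta> (m, c m)) \<le> \<gamma> + ?r n"
    proof -
      have cM: "c M \<le> n" using choice_path_mem(2)[OF c, of M] M by simp
      \<comment> \<open>Any ranking with this path will do. The assortment \<open>{c M}\<close> with purchase \<open>c M\<close> blocks nothing
        and so yields one.\<close>
      obtain \<sigma> where \<sigma>: "\<sigma> \<in> rankings n" "\<forall>m\<in>{1..M}. arg_min_on \<sigma> (A m) = c m"
        using choice_path_realizable[OF nested c, of "{c M}" "c M"] cM by (auto simp: blocked_def)
      then show ?thesis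
        using realized[OF \<sigma>] valid_revenues_bounds(2)[OF r, of "purchase \<sigma>"] purchase_mem[OF \<sigma>(1)]
        by linarith
    qed
    have "(\<Sum>m=1..M. - \<beta> (m, c m)) - (\<Sum>m=1..M. pen m) \<le> ?K"
    proof (cases "k \<in> S")
      case False
      then show ?thesis using weak sum_nonneg[of "{1..M}" pen] pen_nonneg X[OF k] by simp
    next
      case kS: True
      show ?thesis
      proof (cases "\<exists>m\<in>{1..M}. blocked A k m (c m) \<and> c m \<in> S")
        case True
        then obtain m where m: "m \<in> {1..M}" "blocked A k m (c m)" "c m \<in> S" by blast
        then have "pen m = ?r n" using X[OF choice_path_mem(2)[OF c m(1)]] by (simp add: pen_def)
        moreover have "pen m \<le> (\<Sum>m=1..M. pen m)"
          using pen_nonneg m(1) by (intro member_le_sum) auto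
        ultimately show ?thesis using weak rk X[OF k] kS by simp
      next
        case False
        then obtain \<sigma> where \<sigma>: "\<sigma> \<in> rankings n" "\<forall>m\<in>{1..M}. arg_min_on \<sigma> (A m) = c m" "purchase \<sigma> = k"
          using choice_path_realizable[OF nested c _ kS] assortment_facts[OF S] by blast
        then show ?thesis
          using realized[OF \<sigma>(1,2)] sum_nonneg[of "{1..M}" pen] pen_nonneg X[OF k] kS by simp
      qed
    qed
    then show ?thesis by (simp add: sum_subtractf pen_def)
  qed
  define potential where "potential = (\<lambda>k \<pi>. is_potential A M
      (\<lambda>m i. - \<beta> (m, i) - (if blocked A k m i then ?r n * X i else 0)) \<pi> \<and>
      (\<forall>i\<in>A M. \<pi> M i \<le> \<gamma> + ?r n - (?r n - ?r k) * X k))"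
  have "\<exists>\<pi>. potential k \<pi>" if k: "k \<le> n" for k
  proof -
    let ?w = "\<lambda>m i. - \<beta> (m, i) - (if blocked A k m i then ?r n * X i else 0)"
    obtain \<pi> where \<pi>: "is_potential A M ?w \<pi>"
      "\<forall>j\<in>A M. \<exists>c. choice_path A M c \<and> c M = j \<and> (\<Sum>m=1..M. ?w m (c m)) = \<pi> M j"
      using longest_path_potential[OF nested_assortment_facts(1)[OF nested] M
          nested_assortments_preds[OF nested]] by blast
    have "\<pi> M j \<le> \<gamma> + ?r n - (?r n - ?r k) * X k" if j: "j \<in> A M" for j
    proof -
      obtain c where c: "choice_path A M c" "(\<Sum>m=1..M. ?w m (c m)) = \<pi> M j" using \<pi>(2) j by blast
      show ?thesis using path[OF k c(1)] c(2) by simp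
    qed
    then show ?thesis using \<pi>(1) unfolding potential_def by blast
  qed
  then obtain \<pi> where "\<And>k. k \<le> n \<Longrightarrow> potential k (\<pi> k)" by metis
  moreover have "\<gamma> + (\<Sum>p\<in>cells M A. sales d (fst p) (snd p) * \<beta> p) +
      (\<Sum>B\<in>budgets nk (cells M A). radius d * h B) \<le> - target d"
    using val guarantee[OF lam]
    by (simp add: revenue_eq_expectation[OF S] sum_negf mult.commute sum_distrib_left)
  ultimately have "guarantee_certificate n M A nk d X \<gamma> \<beta> h \<pi>"
    using dom unfolding guarantee_certificate_def potential_def by simp
  then show ?thesis by blast
qed

text \<open>
  The flow is compared with optimal multipliers of the best case. For each \<open>k\<close>, every unblocked path
  satisfies the dual inequality of a ranking, and a penalty \<open>P\<close> depending on the multipliers makes the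
  inequality hold for blocked paths, too. The flow does not see the penalty, because it vanishes on
  blocked nodes of the assortment.
\<close>

lemma optimism_certificate_sound:
  assumes cert: "optimism_certificate n M A nk d X F E w t" and U: "U \<noteq> {}"
  shows "\<exists>lam\<in>U. t \<le> revenue n (revs d) lam S"
proof -
  let ?r = "revs d"
  obtain lam \<gamma> \<beta> h where lam: "lam \<in> U" and dom: "dominated (cells M A) (budgets nk (cells M A)) \<beta> h"
    and dual: "\<forall>\<sigma>\<in>rankings n. ?r (purchase \<sigma>) \<le> \<gamma> + (\<Sum>p\<in>cells M A. \<beta> p * hits A \<sigma> p)"
    and val: "\<gamma> + (\<Sum>p\<in>cells M A. \<beta> p * sales d (fst p) (snd p)) +
        radius d * (\<Sum>B\<in>budgets nk (cells M A). h B) = (\<Sum>\<sigma>\<in>rankings n. ?r (purchase \<sigma>) * lam \<sigma>)"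
    using ranking_duality[OF U, where c = "\<lambda>\<sigma>. ?r (purchase \<sigma>)"] by blast
  have flow: "layered_flow A M (F k) (E k)" if "k \<le> n" for k
    using cert that by (simp add: optimism_certificate_def)
  define total where "total = (\<lambda>k. \<Sum>i\<in>A M. F k M i)"
  define size_\<beta> where "size_\<beta> = (\<Sum>p\<in>cells M A. \<bar>\<beta> p\<bar>)"
  have path_ge: "(\<Sum>m=1..M. - \<beta> (m, c m)) \<le> size_\<beta>" if c: "choice_path A M c" for c
  proof -
    have "(\<Sum>m=1..M. - \<beta> (m, c m)) \<le> (\<Sum>m=1..M. \<Sum>i\<in>A m. \<bar>\<beta> (m, i)\<bar>)"
    proof (rule sum_mono)
      fix m assume m: "m \<in> {1..M}"
      have "\<bar>\<beta> (m, c m)\<bar> \<le> (\<Sum>i\<in>A m. \<bar>\<beta> (m, i)\<bar>)"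
        using choice_path_mem(1)[OF c m] nested_assortment_facts(1)[OF nested m]
        by (intro member_le_sum[where f = "\<lambda>i. \<bar>\<beta> (m, i)\<bar>"]) auto
      then show "- \<beta> (m, c m) \<le> (\<Sum>i\<in>A m. \<bar>\<beta> (m, i)\<bar>)" by linarith
    qed
    then show ?thesis by (simp add: size_\<beta>_def sum_cells[OF nested])
  qed
  have "?r k * total k \<le> \<gamma> * total k + (\<Sum>m=1..M. \<Sum>i\<in>A m. \<beta> (m, i) * F k m i)" if k: "k \<le> n" for k
  proof -
    define P where "P = size_\<beta> + \<bar>\<gamma>\<bar> + \<bar>?r k\<bar>"
    define K where "K = (if k \<in> S then \<gamma> - ?r k else size_\<beta>)"
    define pen where "pen = (\<lambda>m i. if blocked A k m i \<and> i \<in> S then P else 0)"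
    have P: "0 \<le> P" by (simp add: P_def size_\<beta>_def sum_nonneg)
    have bound: "(\<Sum>m=1..M. - \<beta> (m, c m) - pen m (c m)) \<le> K" if c: "choice_path A M c" for c
    proof -
      have pen: "0 \<le> (\<Sum>m=1..M. pen m (c m))" using P by (intro sum_nonneg) (simp add: pen_def)
      have "(\<Sum>m=1..M. - \<beta> (m, c m)) - (\<Sum>m=1..M. pen m (c m)) \<le> K"
      proof (cases "k \<in> S")
        case False
        then show ?thesis using path_ge[OF c] pen by (simp add: K_def)
      next
        case kS: True
        show ?thesis
        proof (cases "\<exists>m\<in>{1..M}. blocked A k m (c m) \<and> c m \<in> S")
          case True
          then obtain m where m: "m \<in> {1..M}" "blocked A k m (c m)" "c m \<in> S" by blast
          have "pen m (c m) \<le> (\<Sum>m=1..M. pen m (c m))"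
            using P m(1) by (intro member_le_sum[where f = "\<lambda>m. pen m (c m)"]) (auto simp: pen_def)
          then have "P \<le> (\<Sum>m=1..M. pen m (c m))" using m by (simp add: pen_def)
          then show ?thesis using path_ge[OF c] kS by (simp add: K_def P_def)
        next
          case False
          then obtain \<sigma> where \<sigma>: "\<sigma> \<in> rankings n" "\<forall>m\<in>{1..M}. arg_min_on \<sigma> (A m) = c m" "purchase \<sigma> = k"
            using choice_path_realizable[OF nested c _ kS] assortment_facts[OF S] by blast
          have "?r k \<le> \<gamma> + (\<Sum>m=1..M. \<beta> (m, arg_min_on \<sigma> (A m)))"
            using bspec[OF dual \<sigma>(1)] \<sigma>(3) by (simp add: sum_hits[OF nested \<sigma>(1)])
          also have "(\<Sum>m=1..M. \<beta> (m, arg_min_on \<sigma> (A m))) = (\<Sum>m=1..M. \<beta> (m, c m))"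
            using \<sigma>(2) by (intro sum.cong) auto
          finally have "?r k \<le> \<gamma> + (\<Sum>m=1..M. \<beta> (m, c m))" .
          then show ?thesis using pen kS by (simp add: K_def sum_negf)
        qed
      qed
      then show ?thesis by (simp add: sum_subtractf)
    qed
    have weight: "(\<Sum>m=1..M. \<Sum>i\<in>A m. F k m i * (- \<beta> (m, i) - pen m i)) \<le> K * total k"
      unfolding total_def
      using flow_weight_le_path_bound[OF nested_assortment_facts(1)[OF nested] M
          nested_assortments_preds[OF nested] flow[OF k], where w = "\<lambda>m i. - \<beta> (m, i) - pen m i"] bound
      by blast
    have unpenalized: "F k m i * (- \<beta> (m, i) - pen m i) = - (\<beta> (m, i) * F k m i)"
      if "m \<in> {1..M}" "i \<in> A m" for m i
    proof (cases "blocked A k m i \<and> i \<in> S")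
      case True
      have "i \<le> n" using nested_assortment_facts(3)[OF nested that(1)] that(2) by auto
      then have "F k m i \<le> 0"
        using cert k that True X[of i] unfolding optimism_certificate_def by force
      moreover have "0 \<le> F k m i" using flow[OF k] that by (simp add: layered_flow_def)
      ultimately show ?thesis by simp
    qed (auto simp: pen_def)
    have "(\<Sum>m=1..M. \<Sum>i\<in>A m. F k m i * (- \<beta> (m, i) - pen m i)) =
        (\<Sum>m=1..M. \<Sum>i\<in>A m. - (\<beta> (m, i) * F k m i))"
      by (intro sum.cong refl unpenalized)
    also have "\<dots> = - (\<Sum>m=1..M. \<Sum>i\<in>A m. \<beta> (m, i) * F k m i)" by (simp add: sum_negf)
    finally have "- (\<Sum>m=1..M. \<Sum>i\<in>A m. \<beta> (m, i) * F k m i) \<le> K * total k" using weight by simp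
    moreover have "K * total k = (\<gamma> - ?r k) * total k"
    proof (cases "k \<in> S")
      case False
      have "total k \<le> X k"
        using cert k unfolding optimism_certificate_def total_def by blast
      then have "total k \<le> 0" using X[OF k] False by simp
      moreover have "0 \<le> total k"
        unfolding total_def using flow[OF k] M by (intro sum_nonneg) (simp add: layered_flow_def)
      ultimately show ?thesis by simp
    qed (simp add: K_def)
    ultimately show ?thesis by (simp add: left_diff_distrib)
  qed
  then have "(\<Sum>k\<le>n. ?r k * total k) \<le>
      (\<Sum>k\<le>n. \<gamma> * total k + (\<Sum>m=1..M. \<Sum>i\<in>A m. \<beta> (m, i) * F k m i))"
    by (intro sum_mono) simp
  also have "\<dots> = \<gamma> * (\<Sum>k\<le>n. total k) + (\<Sum>k\<le>n. \<Sum>p\<in>cells M A. \<beta> p * F k (fst p) (snd p))"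
    by (simp add: sum.distrib sum_distrib_left sum_cells[OF nested])
  also have "(\<Sum>k\<le>n. \<Sum>p\<in>cells M A. \<beta> p * F k (fst p) (snd p)) =
      (\<Sum>p\<in>cells M A. \<beta> p * (\<Sum>k\<le>n. F k (fst p) (snd p)))"
    by (subst sum.swap) (simp add: sum_distrib_left)
  also have "\<dots> \<le> (\<Sum>p\<in>cells M A. \<beta> p * sales d (fst p) (snd p)) +
      radius d * (\<Sum>B\<in>budgets nk (cells M A). h B)"
  proof (rule dominated_pairing_le[OF cells_finite[OF nested] budgets_finite[OF cells_finite[OF nested]]
        budgets_subset dom], assumption)
    show "within_budgets (budgets nk (cells M A)) (\<lambda>p. sales d (fst p) (snd p)) (radius d)
        (\<lambda>p. \<Sum>k\<le>n. F k (fst p) (snd p))"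
      unfolding within_budgets_def
    proof
      fix B assume B: "B \<in> budgets nk (cells M A)"
      then have "(\<Sum>p\<in>B. \<bar>(\<Sum>k\<le>n. F k (fst p) (snd p)) - sales d (fst p) (snd p)\<bar>) \<le> (\<Sum>p\<in>B. w p)"
        using cert budgets_subset[OF B] unfolding optimism_certificate_def by (intro sum_mono) blast
      then show "(\<Sum>p\<in>B. \<bar>(\<Sum>k\<le>n. F k (fst p) (snd p)) - sales d (fst p) (snd p)\<bar>) \<le> radius d"
        using cert B unfolding optimism_certificate_def by force
    qed
  qed
  also have "(\<Sum>k\<le>n. total k) = 1" using cert by (simp add: optimism_certificate_def total_def)
  finally have "(\<Sum>k\<le>n. ?r k * total k) \<le> revenue n ?r lam S"
    using val by (simp add: revenue_eq_expectation[OF S])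
  moreover have "t \<le> (\<Sum>k\<le>n. ?r k * total k)"
    using cert by (simp add: optimism_certificate_def total_def sum_distrib_left)
  ultimately show ?thesis using lam by force
qed

text \<open>
  The flows are the probabilities that the purchase is \<open>k\<close> and that the past choices pass through a node
  or along an edge.
\<close>

lemma optimism_certificate_complete:
  assumes lam: "lam \<in> U"
  shows "\<exists>F E w. optimism_certificate n M A nk d X F E w (revenue n (revs d) lam S)"
proof -
  have dist: "lam \<in> ranking_distributions n"
    using lam by (simp add: ambiguity_set_def ranking_distributions_def)
  define c where "c = (\<lambda>m (\<sigma> :: nat \<Rightarrow> nat). arg_min_on \<sigma> (A m))"
  define F where "F = (\<lambda>k m i. mass n lam (\<lambda>\<sigma>. purchase \<sigma> = k \<and> c m \<sigma> = i))"
  define E where "E = (\<lambda>k m i j. mass n lam (\<lambda>\<sigma>. (purchase \<sigma> = k \<and> c m \<sigma> = i) \<and> c (Suc m) \<sigma> = j))"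
  have c_mem: "c m \<sigma> \<in> A m" if "\<sigma> \<in> rankings n" "m \<in> {1..M}" for m \<sigma>
    using choice_path_mem(1)[OF ranking_choices_path[OF nested that(1)] that(2)] by (simp add: c_def)
  have c_step: "c (Suc m) \<sigma> \<in> A (Suc m) \<and> (c (Suc m) \<sigma> = c m \<sigma> \<or> c (Suc m) \<sigma> \<notin> A m)"
    if "\<sigma> \<in> rankings n" "m \<in> {1..<M}" for m \<sigma>
    using ranking_choices_path[OF nested that(1)] that(2) by (simp add: choice_path_def c_def)
  have finA: "finite (A m)" if "m \<in> {1..M}" for m
    using nested_assortment_facts(1)[OF nested that] .
  have flow: "layered_flow A M (F k) (E k)" for k
    unfolding layered_flow_def
  proof (intro conjI ballI)
    fix m i assume m: "m \<in> {1..<M}" and i: "i \<in> A m"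
    have "finite (succs A m i)" using finA[of "Suc m"] m by (simp add: succs_def)
    then show "F k m i = (\<Sum>j\<in>succs A m i. E k m i j)"
      unfolding F_def E_def
      by (subst mass_partition) (use c_step m in \<open>auto simp: succs_def\<close>)
  next
    fix m j assume m: "m \<in> {1..<M}" and j: "j \<in> A (Suc m)"
    have "finite (preds A m j)" using finA[of m] m by (simp add: preds_def)
    then have "(\<Sum>i\<in>preds A m j. mass n lam (\<lambda>\<sigma>. (purchase \<sigma> = k \<and> c (Suc m) \<sigma> = j) \<and> c m \<sigma> = i)) = F k (Suc m) j"
      unfolding F_def
      by (subst mass_partition) (use c_step c_mem m in \<open>auto simp: preds_def\<close>)
    moreover have "E k m i j = mass n lam (\<lambda>\<sigma>. (purchase \<sigma> = k \<and> c (Suc m) \<sigma> = j) \<and> c m \<sigma> = i)" for i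
      unfolding E_def by (rule mass_cong) auto
    ultimately show "F k (Suc m) j = (\<Sum>i\<in>preds A m j. E k m i j)" by simp
  qed (simp_all add: F_def E_def mass_nonneg[OF dist])
  have total: "(\<Sum>i\<in>A M. F k M i) = mass n lam (\<lambda>\<sigma>. purchase \<sigma> = k)" for k
    unfolding F_def using finA c_mem M by (intro mass_partition) auto
  have blocked_flow: "F k m i \<le> 1 - X i" if k: "k \<le> n" and m: "m \<in> {1..M}" and i: "i \<in> A m" and b: "blocked A k m i" for k m i
  proof -
    have "i \<le> n" using nested_assortment_facts(3)[OF nested m] i by auto
    moreover have "F k m i = 0" if "i \<in> S"
      unfolding F_def mass_def
    proof (rule sum.neutral, rule ballI)
      fix \<sigma> assume "\<sigma> \<in> rankings n"
      then show "lam \<sigma> * of_bool (purchase \<sigma> = k \<and> c m \<sigma> = i) = 0"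
        using purchase_not_blocked[of \<sigma> m] m b that by (auto simp: c_def)
    qed
    ultimately show ?thesis using X[of i] mass_le_1[OF dist] by (cases "i \<in> S") (auto simp: F_def)
  qed
  have total_le: "mass n lam (\<lambda>\<sigma>. purchase \<sigma> = k) \<le> X k" if k: "k \<le> n" for k
  proof (cases "k \<in> S")
    case True
    then show ?thesis using X[OF k] mass_le_1[OF dist] by simp
  next
    case False
    then have "mass n lam (\<lambda>\<sigma>. purchase \<sigma> = k) = 0"
      unfolding mass_def using purchase_mem by (intro sum.neutral) auto
    then show ?thesis using X[OF k] False by simp
  qed
  have total_sum: "(\<Sum>k\<le>n. mass n lam (\<lambda>\<sigma>. purchase \<sigma> = k)) = 1"
    using mass_partition[of "{..n}" n "\<lambda>_. True" purchase lam] purchase_mem mass_True[OF dist] by simp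
  have marginals: "(\<Sum>k\<le>n. F k m i) = choice_prob n lam i (A m)" if "m \<in> {1..M}" for m i
  proof -
    have "(\<Sum>k\<le>n. mass n lam (\<lambda>\<sigma>. c m \<sigma> = i \<and> purchase \<sigma> = k)) = mass n lam (\<lambda>\<sigma>. c m \<sigma> = i)"
      using purchase_mem by (intro mass_partition) auto
    then show ?thesis
      by (simp add: F_def choice_prob_def mass_def c_def conj_commute mult.commute eq_commute)
  qed
  have "(\<Sum>k\<le>n. \<Sum>i\<in>A M. revs d k * F k M i) = (\<Sum>k\<le>n. revs d k * mass n lam (\<lambda>\<sigma>. purchase \<sigma> = k))"
    by (simp add: total sum_distrib_left[symmetric])
  also have "\<dots> = revenue n (revs d) lam S"
    using mass_partition_weighted[of "{..n}" n "\<lambda>_. True" purchase "revs d" lam] purchase_mem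
    by (simp add: revenue_eq_expectation[OF S])
  finally have flow_value: "(\<Sum>k\<le>n. \<Sum>i\<in>A M. revs d k * F k M i) = revenue n (revs d) lam S" .
  define w where "w = (\<lambda>p. \<bar>choice_prob n lam (snd p) (A (fst p)) - sales d (fst p) (snd p)\<bar>)"
  have "optimism_certificate n M A nk d X F E w (revenue n (revs d) lam S)"
    unfolding optimism_certificate_def
  proof (intro conjI)
    show "\<forall>p\<in>cells M A. \<bar>(\<Sum>k\<le>n. F k (fst p) (snd p)) - sales d (fst p) (snd p)\<bar> \<le> w p"
      by (auto simp: cells_def marginals w_def)
    show "\<forall>B\<in>budgets nk (cells M A). (\<Sum>p\<in>B. w p) \<le> radius d"
      using lam by (simp add: ambiguity_set_def within_budgets_def marginal_hits w_def)
  qed (use flow blocked_flow total_le total_sum in \<open>simp_all add: total flow_value\<close>)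
  then show ?thesis by blast
qed

text \<open>
  The distribution from strong duality is optimal by weak duality.
\<close>

lemma best_case_attained:
  assumes U: "U \<noteq> {}"
  shows "\<exists>lam\<in>U. \<forall>lam'\<in>U. revenue n (revs d) lam' S \<le> revenue n (revs d) lam S"
proof -
  obtain lam \<gamma> \<beta> h where lam: "lam \<in> U" and dom: "dominated (cells M A) (budgets nk (cells M A)) \<beta> h"
    and dual: "\<And>\<sigma>. \<sigma> \<in> rankings n \<Longrightarrow> revs d (purchase \<sigma>) \<le> \<gamma> + (\<Sum>p\<in>cells M A. \<beta> p * hits A \<sigma> p)"
    and val: "\<gamma> + (\<Sum>p\<in>cells M A. \<beta> p * sales d (fst p) (snd p)) +
        radius d * (\<Sum>B\<in>budgets nk (cells M A). h B) = (\<Sum>\<sigma>\<in>rankings n. revs d (purchase \<sigma>) * lam \<sigma>)"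
    using ranking_duality[OF U, where c = "\<lambda>\<sigma>. revs d (purchase \<sigma>)"] by blast
  have "revenue n (revs d) lam' S \<le> revenue n (revs d) lam S" if "lam' \<in> U" for lam'
    unfolding revenue_eq_expectation[OF S] val[symmetric]
    by (rule expectation_le_dual_value[OF cells_finite[OF nested] budgets_finite[OF cells_finite[OF nested]]
        budgets_subset dom that dual])
  then show ?thesis using lam by blast
qed
end

section \<open>The mixed-integer reformulation\<close>

datatype var = Objective | Base | Price "nat \<times> nat" | Rate "(nat \<times> nat) set"
  | Deviation "nat \<times> nat" | Potential nat nat nat | Flow nat nat nat | Edge nat nat nat nat

definition variables :: "nat \<Rightarrow> nat \<Rightarrow> (nat \<Rightarrow> nat set) \<Rightarrow> norm_kind \<Rightarrow> var set" where
  "variables n M A nk =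
     {Objective, Base} \<union> Price ` cells M A \<union> Rate ` budgets nk (cells M A) \<union> Deviation ` cells M A \<union>
     (\<lambda>(k, m, i). Potential k m i) ` ({..n} \<times> cells M A) \<union>
     (\<lambda>(k, m, i). Flow k m i) ` ({..n} \<times> cells M A) \<union>
     (\<lambda>((k, m, i), j). Edge k m i j) ` (({..n} \<times> cells M A) \<times> {..n})"

text \<open>
  The no-purchase option belongs to every assortment and has no binary variable.
\<close>

definition membership :: "(nat \<Rightarrow> real) \<Rightarrow> nat \<Rightarrow> real" where
  "membership x i = (if i = 0 then 1 else x i)"

definition pareto_system ::
  "nat \<Rightarrow> nat \<Rightarrow> (nat \<Rightarrow> nat set) \<Rightarrow> norm_kind \<Rightarrow> data \<Rightarrow> (nat \<Rightarrow> real) \<Rightarrow> (var \<Rightarrow> real) \<Rightarrow> bool" where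
  "pareto_system n M A nk d x y \<longleftrightarrow>
     guarantee_certificate n M A nk d (membership x) (y Base) (\<lambda>p. y (Price p)) (\<lambda>B. y (Rate B))
       (\<lambda>k m i. y (Potential k m i)) \<and>
     optimism_certificate n M A nk d (membership x) (\<lambda>k m i. y (Flow k m i))
       (\<lambda>k m i j. y (Edge k m i j)) (\<lambda>p. y (Deviation p)) (y Objective)"

lemma linear_expr_membership:
  assumes "i \<le> n" "coefficient n M a"
  shows "linear_expr n M J (\<lambda>d x y. a d * membership x i)"
  using assms linear_expr_binary[of i n M a J]
  by (cases "i = 0") (simp_all add: membership_def linear_expr_coefficient)

lemma linear_expr_if:
  assumes "b \<Longrightarrow> linear_expr n M J L" "\<not> b \<Longrightarrow> linear_expr n M J L'"
  shows "linear_expr n M J (\<lambda>d x y. if b then L d x y else L' d x y)"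
  using assms by (cases b) simp_all

text \<open>
  The left-hand sides are the numbers of constraints of the two certificates, where \<open>q\<close> bounds the
  numbers of products, of layers and of nodes per layer.
\<close>

lemma constraint_count_le:
  fixes q :: nat
  assumes "1 \<le> q"
  shows "(q * q * 1 + q * q * 2) + (1 + (q * (q * 1 + q * (q * (q * 1))) + q * (q * 1))) \<le> 20 * q ^ 4"
    "q * (q * (q * 1) + (q * (q * (q * 1)) + (q * (q * 2) + q * (q * 2)))) +
      (q * (q * (q * 1)) + (q * 1 + (2 + (q * q * 2 + (q * q * 1 + 1))))) \<le> 20 * q ^ 4"
proof -
  have "q ^ l \<le> q ^ 4" if "l \<le> 4" for l using assms that by (intro power_increasing) auto
  from this[of 0] this[of 1] this[of 2] this[of 3]
  have "1 \<le> q ^ 4" "q \<le> q ^ 4" "q * q \<le> q ^ 4" "q * (q * q) \<le> q ^ 4" "q * (q * (q * q)) = q ^ 4"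
    by (simp_all add: power2_eq_square power3_eq_cube power4_eq_xxxx mult.assoc)
  then show "(q * q * 1 + q * q * 2) + (1 + (q * (q * 1 + q * (q * (q * 1))) + q * (q * 1))) \<le> 20 * q ^ 4"
    "q * (q * (q * 1) + (q * (q * (q * 1)) + (q * (q * 2) + q * (q * 2)))) +
      (q * (q * (q * 1)) + (q * 1 + (2 + (q * q * 2 + (q * q * 1 + 1))))) \<le> 20 * q ^ 4"
    unfolding distrib_left mult_1_right mult_2_right by linarith+
qed

context
  fixes n M :: nat and A :: "nat \<Rightarrow> nat set" and nk :: norm_kind
  assumes nested: "nested_assortments n M A" and n: "1 \<le> n" and M: "1 \<le> M"
begin

private abbreviation (input) "J \<equiv> variables n M A nk"
private abbreviation (input) "q \<equiv> n + M"

lemma card_products_le: "card {..n} \<le> q"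
  using M by simp

lemma card_assortment_le: "m \<in> {1..M} \<Longrightarrow> card (A m) \<le> q"
  using nested_assortment_facts(3)[OF nested] card_mono[of "{..n}" "A m"] M by fastforce

lemma card_succs_le: "m \<in> {1..<M} \<Longrightarrow> card (succs A m i) \<le> q"
  using card_assortment_le[of "Suc m"] card_mono[of "A (Suc m)" "succs A m i"]
    nested_assortment_facts(1)[OF nested, of "Suc m"]
  by (fastforce simp: succs_def)

lemma card_cells_le: "card (cells M A) \<le> q * q"
proof -
  have "card (cells M A) = (\<Sum>m=1..M. card (A m))"
    unfolding cells_def using nested_assortment_facts(1)[OF nested] by (intro card_SigmaI) auto
  also have "\<dots> \<le> (\<Sum>m=1..M. q)" using card_assortment_le by (intro sum_mono)
  also have "\<dots> \<le> q * q" by simp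
  finally show ?thesis .
qed

lemma card_budgets_cells_le: "card (budgets nk (cells M A)) \<le> q * q"
proof -
  have "(1, 0) \<in> cells M A" using nested_assortment_facts(2)[OF nested, of 1] M by (simp add: cells_def)
  then have "cells M A \<noteq> {}" by auto
  then show ?thesis
    using card_budgets_le[OF cells_finite[OF nested], of nk] card_cells_le by linarith
qed

lemma finite_index_sets:
  "finite (cells M A)" "finite (budgets nk (cells M A))" "m \<in> {1..M} \<Longrightarrow> finite (A m)"
  "m \<in> {1..<M} \<Longrightarrow> finite (succs A m i)"
  using cells_finite[OF nested] budgets_finite nested_assortment_facts(1)[OF nested]
    finite_subset[of "succs A m i" "A (Suc m)"] nested_assortment_facts(1)[OF nested, of "Suc m"]
  by (auto simp: succs_def)

lemma variables_finite: "finite J"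
  unfolding variables_def using finite_index_sets(1,2) by simp

lemma card_variables_le: "card J \<le> 8 * q ^ 4"
proof -
  let ?Q = "q ^ 4"
  have q: "1 \<le> q" using n by simp
  have pow: "q ^ l \<le> ?Q" if "l \<le> 4" for l using q that by (intro power_increasing) auto
  have img: "card (f ` X) \<le> K" if "finite X" "card X \<le> K" for f :: "'b \<Rightarrow> var" and X K
    using card_image_le[OF that(1), of f] that(2) by simp
  have cells: "card (cells M A) \<le> ?Q" and budgets: "card (budgets nk (cells M A)) \<le> ?Q"
    using card_cells_le card_budgets_cells_le pow[of 2] by (simp_all add: power2_eq_square)
  have tri_q: "card ({..n} \<times> cells M A) \<le> q * (q * q)"
    unfolding card_cartesian_product by (rule mult_le_mono[OF card_products_le card_cells_le])
  then have tri: "card ({..n} \<times> cells M A) \<le> ?Q"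
    using pow[of 3] by (simp add: power3_eq_cube mult.assoc)
  have "card (({..n} \<times> cells M A) \<times> {..n}) \<le> q * (q * q) * q"
    unfolding card_cartesian_product[of "{..n} \<times> cells M A"] by (rule mult_le_mono[OF tri_q card_products_le])
  then have quad: "card (({..n} \<times> cells M A) \<times> {..n}) \<le> ?Q"
    by (simp add: power4_eq_xxxx mult.assoc)
  have two: "card {Objective, Base} \<le> ?Q + ?Q" using pow[of 0] by simp
  have fin: "finite ({..n} \<times> cells M A)" "finite (({..n} \<times> cells M A) \<times> {..n})"
    using finite_index_sets(1) by auto
  have "card J \<le> ?Q + ?Q + ?Q + ?Q + ?Q + ?Q + ?Q + ?Q"
    unfolding variables_def
    by (intro order.trans[OF card_Un_le] add_mono two img cells budgets tri quad fin finite_index_sets(1,2))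
  then show ?thesis by simp
qed

lemma mem_variables:
  "Objective \<in> J" "Base \<in> J" "p \<in> cells M A \<Longrightarrow> Price p \<in> J" "p \<in> cells M A \<Longrightarrow> Deviation p \<in> J"
  "B \<in> budgets nk (cells M A) \<Longrightarrow> Rate B \<in> J"
  "k \<le> n \<Longrightarrow> m \<in> {1..M} \<Longrightarrow> i \<in> A m \<Longrightarrow> Potential k m i \<in> J"
  "k \<le> n \<Longrightarrow> m \<in> {1..M} \<Longrightarrow> i \<in> A m \<Longrightarrow> Flow k m i \<in> J"
  "k \<le> n \<Longrightarrow> m \<in> {1..M} \<Longrightarrow> i \<in> A m \<Longrightarrow> j \<le> n \<Longrightarrow> Edge k m i j \<in> J"
  unfolding variables_def cells_def by (auto simp: image_iff)

lemma assortment_le: "m \<in> {1..M} \<Longrightarrow> i \<in> A m \<Longrightarrow> i \<le> n"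
  using nested_assortment_facts(3)[OF nested] by blast

lemma succs_mem: "m < M \<Longrightarrow> j \<in> succs A m i \<Longrightarrow> j \<in> A (Suc m) \<and> j \<le> n"
  using assortment_le[of "Suc m" j] by (auto simp: succs_def)

lemma preds_mem: "i \<in> preds A m j \<Longrightarrow> i \<in> A m"
  by (simp add: preds_def)

lemma next_assortment_le: "m < M \<Longrightarrow> j \<in> A (Suc m) \<Longrightarrow> j \<le> n"
  using assortment_le[of "Suc m" j] by simp

lemma cells_I: "m \<in> {1..M} \<Longrightarrow> i \<in> A m \<Longrightarrow> (m, i) \<in> cells M A"
  by (simp add: cells_def)

lemma cells_mem: "p \<in> cells M A \<Longrightarrow> fst p \<in> {1..M} \<and> snd p \<in> A (fst p) \<and> snd p \<le> n"
  using assortment_le[of "fst p" "snd p"] by (auto simp: cells_def)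

lemma linear_expr_membership_1: "i \<le> n \<Longrightarrow> linear_expr n M J (\<lambda>d x y. membership x i)"
  using linear_expr_membership[of i n M "\<lambda>_. 1"] by (simp add: coefficient_const)

lemmas linear_intros =
  linear_expr_variable[OF variables_finite] linear_expr_continuous[OF variables_finite]
  linear_expr_membership linear_expr_membership_1 linear_expr_if linear_expr_add linear_expr_diff linear_expr_uminus
  linear_expr_sum linear_expr_coefficient
  coefficient_const coefficient_revs coefficient_sales coefficient_radius coefficient_target
  coefficient_uminus coefficient_diff mem_variables

lemma dominated_linear_system:
  "linear_system n M J (q * q * 1 + q * q * 2)
     (\<lambda>d x y. dominated (cells M A) (budgets nk (cells M A)) (\<lambda>p. y (Price p)) (\<lambda>B. y (Rate B)))"
  unfolding dominated_def
  by (intro linear_system_conj linear_system_ball linear_system_le linear_system_abs_le finite_index_sets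
      card_budgets_cells_le card_cells_le linear_intros) auto

lemma potential_linear_system:
  assumes k: "k \<le> n"
    and w: "\<And>m i. m \<in> {1..M} \<Longrightarrow> i \<in> A m \<Longrightarrow> linear_expr n M J (\<lambda>d x y. w m i d x y)"
  shows "linear_system n M J (q * 1 + q * (q * (q * 1)))
     (\<lambda>d x y. is_potential A M (\<lambda>m i. w m i d x y) (\<lambda>m i. y (Potential k m i)))"
  unfolding is_potential_def
proof (intro linear_system_conj linear_system_ball linear_system_le linear_expr_add
    linear_expr_variable[OF variables_finite] mem_variables w k)
  show "card {1..<M} \<le> q" by simp
qed (use M in \<open>auto intro: finite_index_sets card_assortment_le card_succs_le dest: succs_mem\<close>)

lemma flow_linear_system:
  assumes k: "k \<le> n"
  shows "linear_system n M J
     (q * (q * 1) + (q * (q * (q * 1)) + (q * (q * 2) + q * (q * 2))))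
     (\<lambda>d x y. layered_flow A M (\<lambda>m i. y (Flow k m i)) (\<lambda>m i j. y (Edge k m i j)))"
  unfolding layered_flow_def
proof (intro linear_system_conj linear_system_ball linear_system_le linear_system_eq linear_expr_sum
    linear_expr_variable[OF variables_finite] linear_expr_coefficient coefficient_const mem_variables k)
  show "card {1..<M} \<le> q" "card {1..<M} \<le> q" "card {1..<M} \<le> q" by simp_all
qed (use M in \<open>auto intro: finite_index_sets card_assortment_le card_succs_le assortment_le dest: succs_mem preds_mem next_assortment_le\<close>)

lemma guarantee_linear_system:
  "linear_system n M J (20 * q ^ 4) (\<lambda>d x y. guarantee_certificate n M A nk d (membership x) (y Base)
     (\<lambda>p. y (Price p)) (\<lambda>B. y (Rate B)) (\<lambda>k m i. y (Potential k m i)))"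
proof (rule linear_system_mono)
  show "linear_system n M J ((q * q * 1 + q * q * 2) + (1 + (q * (q * 1 + q * (q * (q * 1))) + q * (q * 1))))
     (\<lambda>d x y. guarantee_certificate n M A nk d (membership x) (y Base)
     (\<lambda>p. y (Price p)) (\<lambda>B. y (Rate B)) (\<lambda>k m i. y (Potential k m i)))"
    unfolding guarantee_certificate_def
  proof (intro linear_system_conj dominated_linear_system linear_system_ball potential_linear_system
      linear_system_le linear_intros card_products_le card_assortment_le)
  qed (use M in \<open>auto intro: finite_index_sets assortment_le cells_I dest: cells_mem subsetD[OF budgets_subset]\<close>)
next
  show "(q * q * 1 + q * q * 2) + (1 + (q * (q * 1 + q * (q * (q * 1))) + q * (q * 1))) \<le> 20 * q ^ 4"
    using n by (intro constraint_count_le) simp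
qed

lemma optimism_linear_system:
  "linear_system n M J (20 * q ^ 4) (\<lambda>d x y. optimism_certificate n M A nk d (membership x)
     (\<lambda>k m i. y (Flow k m i)) (\<lambda>k m i j. y (Edge k m i j)) (\<lambda>p. y (Deviation p)) (y Objective))"
proof (rule linear_system_mono)
  show "linear_system n M J (q * (q * (q * 1) + (q * (q * (q * 1)) + (q * (q * 2) + q * (q * 2)))) +
      (q * (q * (q * 1)) + (q * 1 + (2 + (q * q * 2 + (q * q * 1 + 1))))))
     (\<lambda>d x y. optimism_certificate n M A nk d (membership x)
     (\<lambda>k m i. y (Flow k m i)) (\<lambda>k m i j. y (Edge k m i j)) (\<lambda>p. y (Deviation p)) (y Objective))"
    unfolding optimism_certificate_def
  proof (intro linear_system_conj linear_system_ball linear_system_imp flow_linear_system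
      linear_system_le linear_system_eq linear_system_abs_le linear_intros card_products_le
      card_assortment_le card_cells_le card_budgets_cells_le)
  qed (use M in \<open>auto intro: finite_index_sets assortment_le cells_I dest: cells_mem subsetD[OF budgets_subset]\<close>)
next
  show "q * (q * (q * 1) + (q * (q * (q * 1)) + (q * (q * 2) + q * (q * 2)))) +
      (q * (q * (q * 1)) + (q * 1 + (2 + (q * q * 2 + (q * q * 1 + 1))))) \<le> 20 * q ^ 4"
    using n by (intro constraint_count_le) simp
qed
end

text \<open>
  Feasible points of \<open>G\<close> never overestimate the objective of the assortment they encode, and for each
  feasible assortment some point is exact; intermediate points may underestimate.
\<close>

lemma reformulatesI:
  assumes sound: "\<And>z. z \<in> G \<Longrightarrow> decode z \<in> F \<and> g z \<le> f (decode z)"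
    and complete: "\<And>s. s \<in> F \<Longrightarrow> \<exists>z\<in>G. decode z = s \<and> g z = f s"
  shows "reformulates decode G g F f"
  unfolding reformulates_def
proof (intro conjI allI impI)
  show "optimal_value G g = optimal_value F f"
    unfolding optimal_value_def
  proof (rule antisym; rule SUP_least)
    fix z assume "z \<in> G"
    then show "ereal (g z) \<le> (SUP s\<in>F. ereal (f s))"
      using sound[of z] by (intro SUP_upper2[of "decode z"]) auto
  next
    fix s assume "s \<in> F"
    then obtain z where "z \<in> G" "g z = f s" using complete by blast
    then show "ereal (f s) \<le> (SUP z\<in>G. ereal (g z))" by (intro SUP_upper2[of z]) auto
  qed
next
  assume "\<exists>s. optimal_solution F f s"
  then obtain s where s: "s \<in> F" "\<And>s'. s' \<in> F \<Longrightarrow> f s' \<le> f s"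
    by (auto simp: optimal_solution_def is_arg_max_linorder)
  then obtain z where "z \<in> G" "g z = f s" using complete by blast
  then have "optimal_solution G g z"
    using sound s(2) by (fastforce simp: optimal_solution_def is_arg_max_linorder)
  then show "\<exists>z. optimal_solution G g z" ..
next
  fix z assume "optimal_solution G g z"
  then have z: "z \<in> G" "\<And>z'. z' \<in> G \<Longrightarrow> g z' \<le> g z"
    by (auto simp: optimal_solution_def is_arg_max_linorder)
  have "f s \<le> f (decode z)" if "s \<in> F" for s
    using complete[OF that] z sound[OF z(1)] by (metis order.trans)
  then show "optimal_solution F f (decode z)"
    using sound[OF z(1)] by (auto simp: optimal_solution_def is_arg_max_linorder)
qed


lemma revenue_nonneg:
  assumes "valid_revenues n r" "S \<in> assortments n" "lam \<in> ranking_distributions n"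
  shows "0 \<le> revenue n r lam S"
proof -
  have "0 \<le> r (arg_min_on \<sigma> S)" if "\<sigma> \<in> rankings n" for \<sigma>
    using valid_revenues_bounds(1)[OF assms(1)] arg_min_on_ranking(1)[OF that]
      assortment_facts[OF assms(2)] by blast
  then show ?thesis
    unfolding revenue_eq_expectation[OF assms(2)] using assms(3)
    by (intro sum_nonneg mult_nonneg_nonneg) (auto simp: ranking_distributions_def)
qed

lemma worst_case_ge_iff:
  assumes r: "valid_revenues n r" and S: "S \<in> assortments n" and U: "U \<noteq> {}" "U \<subseteq> ranking_distributions n"
  shows "\<theta> \<le> worst_case n r U S \<longleftrightarrow> (\<forall>lam\<in>U. \<theta> \<le> revenue n r lam S)"
proof -
  have "bdd_below ((\<lambda>lam. revenue n r lam S) ` U)"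
    using revenue_nonneg[OF r S] U(2) by (intro bdd_belowI2[of _ 0]) auto
  then show ?thesis unfolding worst_case_def using U(1) by (simp add: le_cINF_iff)
qed

text \<open>
  The value \<open>40\<close> is the sum of the two bounds \<open>20\<close> on the constraint counts. The exponent \<open>4\<close> stems
  from the edges: one graph for each product, at most \<open>M\<close> layers, and pairs of products.
\<close>

theorem theorem8:
  "\<exists>C d :: nat. \<forall>(n :: nat) (M :: nat) (A :: nat \<Rightarrow> nat set) (nk :: norm_kind).
     1 \<le> n \<longrightarrow> 1 \<le> M \<longrightarrow> nested_assortments n M A \<longrightarrow>
     (\<exists>T :: affine_form milp.
        n \<le> num_bin T \<and> num_bin T \<le> C * n \<and>
        num_cont T \<le> C * (n + M) ^ d \<and>
        num_con T \<le> C * (n + M) ^ d \<and>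
        (\<forall>(r :: nat \<Rightarrow> real) (v :: nat \<Rightarrow> nat \<Rightarrow> real) (\<eta> :: real) (\<theta> :: real).
           valid_revenues n r \<longrightarrow> valid_sales n M A v \<longrightarrow> 0 \<le> \<eta> \<longrightarrow>
           uncertainty_set n M A nk v \<eta> \<noteq> {} \<longrightarrow>
           reformulates (decode_assortment n)
             (milp_feasible (instantiate n M r v \<eta> \<theta> T))
             (milp_objective (instantiate n M r v \<eta> \<theta> T))
             (pareto_feasible n r (uncertainty_set n M A nk v \<eta>) \<theta>)
             (best_case n r (uncertainty_set n M A nk v \<eta>))))"
proof (rule exI[of _ 40], rule exI[of _ 4], intro allI impI)
  fix n M :: nat and A nk
  assume n: "1 \<le> n" and M: "1 \<le> M" and nested: "nested_assortments n M A"
  let ?J = "variables n M A nk"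
  have "linear_system n M ?J (20 * (n + M) ^ 4 + 20 * (n + M) ^ 4) (\<lambda>d x y. pareto_system n M A nk d x y)"
    unfolding pareto_system_def
    by (rule linear_system_conj[OF guarantee_linear_system[OF nested n M] optimism_linear_system[OF nested n M]])
  then have system: "linear_system n M ?J (40 * (n + M) ^ 4) (pareto_system n M A nk)" by simp
  have J: "finite ?J" "Objective \<in> ?J" "card ?J \<le> 8 * (n + M) ^ 4"
    using variables_finite[OF nested n M] card_variables_le[OF nested n M] mem_variables(1)[OF nested n M] by blast+
  obtain T e where T: "num_bin T = n" "num_cont T = card ?J" "num_con T \<le> 40 * (n + M) ^ 4" "inj_on e ?J"
    "\<And>r v \<eta> \<theta> x y. (x, y) \<in> milp_feasible (instantiate n M r v \<eta> \<theta> T) \<longleftrightarrow>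
       (\<forall>i\<in>{1..n}. x i \<in> {0, 1}) \<and> pareto_system n M A nk (Data r v \<eta> \<theta>) x (\<lambda>j. y (e j))"
    "\<And>r v \<eta> \<theta> x y. milp_objective (instantiate n M r v \<eta> \<theta> T) (x, y) = y (e Objective)"
    using linear_system_milp[OF J(1,2) system] by blast
  have "reformulates (decode_assortment n)
      (milp_feasible (instantiate n M r v \<eta> \<theta> T)) (milp_objective (instantiate n M r v \<eta> \<theta> T))
      (pareto_feasible n r (uncertainty_set n M A nk v \<eta>) \<theta>)
      (best_case n r (uncertainty_set n M A nk v \<eta>))"
    if r: "valid_revenues n r" and U_nonempty: "uncertainty_set n M A nk v \<eta> \<noteq> {}" for r v \<eta> \<theta>
  proof -
    let ?U = "uncertainty_set n M A nk v \<eta>" and ?d = "Data r v \<eta> \<theta>"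
    have U: "?U = ranking_ambiguity n M A nk v \<eta>"
      by (rule uncertainty_set_eq_ranking_ambiguity[OF nested M])
    have U_dist: "?U \<subseteq> ranking_distributions n" by (auto simp: uncertainty_set_def)
    have best: "\<exists>lam\<in>?U. best_case n r ?U S = revenue n r lam S \<and> (\<forall>lam'\<in>?U. revenue n r lam' S \<le> revenue n r lam S)"
      if S: "S \<in> assortments n" for S
    proof -
      obtain lam where lam: "lam \<in> ?U" "\<forall>lam'\<in>?U. revenue n r lam' S \<le> revenue n r lam S"
        using best_case_attained[OF nested M S, of "\<lambda>i. of_bool (i \<in> S)" nk ?d] U_nonempty unfolding U by auto
      then have "best_case n r ?U S = revenue n r lam S"
        unfolding best_case_def by (intro cSup_eq_maximum) auto
      then show ?thesis using lam by blast
    qed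
    show ?thesis
    proof (rule reformulatesI)
      fix z assume z: "z \<in> milp_feasible (instantiate n M r v \<eta> \<theta> T)"
      obtain x y where xy: "z = (x, y)" by force
      define S where "S = decode_assortment n z"
      have S: "S \<in> assortments n" by (auto simp: S_def decode_assortment_def assortments_def xy)
      have bin: "\<forall>i\<in>{1..n}. x i \<in> {0, 1}" and sys: "pareto_system n M A nk ?d x (\<lambda>j. y (e j))"
        using z T(5) by (auto simp: xy)
      have X: "membership x i = of_bool (i \<in> S)" if "i \<le> n" for i
        using bspec[OF bin, of i] that by (auto simp: membership_def S_def decode_assortment_def xy)
      have "\<theta> \<le> revenue n r lam S" if "lam \<in> ?U" for lam
        using guarantee_certificate_sound[OF nested M S X, of nk ?d _ _ _ _ lam] sys that
        unfolding pareto_system_def U by auto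
      then have "S \<in> pareto_feasible n r ?U \<theta>"
        using worst_case_ge_iff[OF r S U_nonempty U_dist] S by (simp add: pareto_feasible_def)
      moreover have "\<exists>lam\<in>?U. y (e Objective) \<le> revenue n r lam S"
        using optimism_certificate_sound[OF nested M S X, of nk ?d] sys U_nonempty
        unfolding pareto_system_def U by auto
      then have "y (e Objective) \<le> best_case n r ?U S" using best[OF S] by fastforce
      ultimately show "decode_assortment n z \<in> pareto_feasible n r ?U \<theta> \<and>
          milp_objective (instantiate n M r v \<eta> \<theta> T) z \<le> best_case n r ?U (decode_assortment n z)"
        by (simp add: xy T(6) S_def)
    next
      fix S assume "S \<in> pareto_feasible n r ?U \<theta>"
      then have S: "S \<in> assortments n" and worst: "\<forall>lam\<in>?U. \<theta> \<le> revenue n r lam S"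
        using worst_case_ge_iff[OF r _ U_nonempty U_dist] by (auto simp: pareto_feasible_def)
      obtain lam where lam: "lam \<in> ?U" "best_case n r ?U S = revenue n r lam S" using best[OF S] by blast
      define x where "x = (\<lambda>i. of_bool (i \<in> S) :: real)"
      have X: "membership x i = of_bool (i \<in> S)" for i
        using S by (simp add: membership_def x_def assortments_def)
      obtain \<gamma> \<beta> h \<pi> where guarantee: "guarantee_certificate n M A nk ?d (membership x) \<gamma> \<beta> h \<pi>"
        using guarantee_certificate_complete[OF nested M S X, of ?d nk] r U_nonempty worst unfolding U by auto
      obtain F E w where optimism: "optimism_certificate n M A nk ?d (membership x) F E w (revenue n r lam S)"
        using optimism_certificate_complete[OF nested M S X, of lam nk ?d] lam(1) unfolding U by auto
      define Y where "Y = case_var (revenue n r lam S) \<gamma> \<beta> h w \<pi> F E"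
      have sys: "pareto_system n M A nk ?d x Y"
        using guarantee optimism by (simp add: pareto_system_def Y_def)
      define y where "y = (\<lambda>l. Y (inv_into ?J e l))"
      have y: "y (e j) = Y j" if "j \<in> ?J" for j using T(4) that by (simp add: y_def)
      have "pareto_system n M A nk ?d x (\<lambda>j. y (e j))"
        using sys linear_system_cong[OF system, of "\<lambda>j. y (e j)" Y ?d x] y by simp
      then have "(x, y) \<in> milp_feasible (instantiate n M r v \<eta> \<theta> T)" by (simp add: T(5) x_def)
      moreover have "decode_assortment n (x, y) = S"
        using S by (auto simp: decode_assortment_def x_def assortments_def)
      moreover have "milp_objective (instantiate n M r v \<eta> \<theta> T) (x, y) = best_case n r ?U S"
        by (simp add: T(6) y[OF J(2)] Y_def lam(2))
      ultimately show "\<exists>z\<in>milp_feasible (instantiate n M r v \<eta> \<theta> T). decode_assortment n z = S \<and>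
          milp_objective (instantiate n M r v \<eta> \<theta> T) z = best_case n r ?U S" by blast
    qed
  qed
  then show "\<exists>T :: affine_form milp. n \<le> num_bin T \<and> num_bin T \<le> 40 * n \<and>
      num_cont T \<le> 40 * (n + M) ^ 4 \<and> num_con T \<le> 40 * (n + M) ^ 4 \<and>
      (\<forall>r v \<eta> \<theta>. valid_revenues n r \<longrightarrow> valid_sales n M A v \<longrightarrow> 0 \<le> \<eta> \<longrightarrow>
         uncertainty_set n M A nk v \<eta> \<noteq> {} \<longrightarrow>
         reformulates (decode_assortment n)
           (milp_feasible (instantiate n M r v \<eta> \<theta> T)) (milp_objective (instantiate n M r v \<eta> \<theta> T))
           (pareto_feasible n r (uncertainty_set n M A nk v \<eta>) \<theta>)
           (best_case n r (uncertainty_set n M A nk v \<eta>)))"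
    using T(1-3) J(3) by (intro exI[of _ T]) simp
qed

end
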